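(* For every positive integer $d$, the $d$-sos-profile $\mathcal S_d$ is a basic semialgebraic set in $\mathbb{R}^s_{\ge0}$ (where $s=|\mathcal V_d|$) containing the graph profile $\mathcal G_{\mathcal V_d}$, and its tropicalization $\operatorname{trop}(\mathcal S_d)$ is the rational polyhedral cone $\log(S^{2\times2}_{\tilde{\mathcal M}_d})$.
   Context: Graphs are finite, simple. $t(H;G)$ is the probability that a uniformly random map $V(H)\to V(G)$ maps edges to edges. A partially labeled graph is a graph without isolated vertices in which some vertices receive distinct labels from $\{1,2,\ldots\}$ (unlabeled if none); the empty graph is denoted $1$. A graph combination is a finite formal $\mathbb R$-linear combination of partially labeled graphs. The product $H_1H_2$ glues vertices with equal labels (keeping one copy of doubled edges), extended bilinearly; $[[\cdot]]$ (unlabeling) removes all labels. For unlabeled $a=\sum\alpha_iH_i$, $a(G)=\sum\alpha_it(H_i;G)$. A $d$-sos graph combination is $\sum_j[[a_j^2]]$ where each constituent graph of each $a_j$ has at most $d$ edges. Fix an integer $\ell(d)$ such that every $d$-sos graph combination can be written with all $a_j$ using only labels in $\{1,\ldots,\ell(d)\}$. $\mathcal B_d$ is the set consisting of $1$ and all partially labeled graphs with labels in $\{1,\ldots,\ell(d)\}$, at most $d$ edges and no isolated vertices; $\mathcal V_d=\{[[AB]]\text{ connected}: A,B\in\mathcal B_d\}\setminus\{1\}$, $s=|\mathcal V_d|$. Every unlabeled graph appearing in a $d$-sos combination or as $[[AB]]$ ($A,B\in\mathcal B_d$) is a disjoint union of graphs in $\mathcal V_d$, hence a monomial in variables $x_C$,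 $C\in\mathcal V_d$; a graph combination is evaluated at $\mathbf v\in\mathbb{R}^s$ by substituting $v_C$ for $x_C$. $\mathcal S_d=\{\mathbf v\in\mathbb{R}^s_{\ge0}: a(\mathbf v)\ge0 \text{ for every } d\text{-sos graph combination } a\}$. The graph profile $\mathcal G_{\mathcal V_d}$ is the closure of $\{(t(C;G))_{C\in\mathcal V_d}\}$ over all graphs $G$. $\tilde{\mathcal B}_d\subseteq\mathcal B_d$ consists of $1$ and all graphs in $\mathcal B_d$ with no unlabeled connected component; $\tilde{\mathcal M}_d$ is the symmetric matrix indexed by $\tilde{\mathcal B}_d$ with $(A,B)$ entry the monomial $[[AB]]$. For a symmetric matrix $M$ of monomials in $x_C$, $S^{2\times2}_M=\{\mathbf v\in\mathbb{R}^s_{\ge0}: \text{all }2\times2\text{ principal minors of }M(\mathbf v)\text{ are}\ge0\}$. $\log(\mathcal S)$ is the image of $\mathcal S\cap\mathbb{R}^s_{>0}$ under coordinatewise natural log; $\operatorname{trop}(\mathcal S)$ is the set of $\mathbf y$ for which there are $\tau_k\in(0,1)$, $\tau_k\to0$, $\mathbf y(k)\in\mathcal S\cap\mathbb{R}^s_{>0}$ with $\frac{-1}{\log_e\tau_k}\log(\mathbf y(k))\to\mathbf y$. *)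

theory Defs
  imports "HOL-Analysis.Analysis" "HOL-Library.Poly_Mapping" "HOL-Library.Multiset"
begin

section \<open>Partially labeled graphs\<close>

text \<open>
  A graph without isolated vertices is determined by its edge set. The vertex carrying label \<open>i\<close>
  is taken to be \<open>Lab i\<close> itself, so distinct vertices carry distinct labels, and gluing along
  equal labels is the union of the edge sets once the unlabeled vertices have been made disjoint.
  Graphs are identified up to isomorphisms that preserve labels (and the absence of labels).
\<close>

datatype vertex = Lab nat | Unl nat

definition pl_edges :: "vertex set set \<Rightarrow> bool" where
  "pl_edges E \<longleftrightarrow> finite E \<and> (\<forall>e\<in>E. card e = 2) \<and> Lab 0 \<notin> \<Union>E"

definition pl_iso_via :: "(vertex \<Rightarrow> vertex) \<Rightarrow> vertex set set \<Rightarrow> vertex set set \<Rightarrow> bool" where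
  "pl_iso_via f E F \<longleftrightarrow>
     inj_on f (\<Union>E) \<and> (\<forall>v\<in>\<Union>E. \<forall>i. f v = Lab i \<longleftrightarrow> v = Lab i) \<and> F = (\<lambda>e. f ` e) ` E"

definition pl_iso :: "vertex set set \<Rightarrow> vertex set set \<Rightarrow> bool" where
  "pl_iso E F \<longleftrightarrow> pl_edges E \<and> pl_edges F \<and> (\<exists>f. pl_iso_via f E F)"

lemma pl_iso_via_Union: "pl_iso_via f E F \<Longrightarrow> \<Union>F = f ` \<Union>E"
  by (auto simp: pl_iso_via_def)

lemma pl_iso_via_inj: "pl_iso_via f E F \<Longrightarrow> inj_on f (\<Union>E)"
  unfolding pl_iso_via_def by (rule conjunct1)

lemma pl_iso_via_Lab: "pl_iso_via f E F \<Longrightarrow> v \<in> \<Union>E \<Longrightarrow> f v = Lab i \<longleftrightarrow> v = Lab i"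
  unfolding pl_iso_via_def by blast

lemma pl_iso_via_edges: "pl_iso_via f E F \<Longrightarrow> F = (\<lambda>e. f ` e) ` E"
  unfolding pl_iso_via_def by blast

lemma pl_iso_via_trans:
  assumes "pl_iso_via f E F" "pl_iso_via g F G"
  shows "pl_iso_via (g \<circ> f) E G"
proof -
  have U: "\<Union>F = f ` \<Union>E" using assms(1) by (rule pl_iso_via_Union)
  have "inj_on (g \<circ> f) (\<Union>E)"
    using comp_inj_on[OF pl_iso_via_inj[OF assms(1)]] pl_iso_via_inj[OF assms(2)]
    unfolding U by blast
  moreover have "\<forall>v\<in>\<Union>E. \<forall>i. (g \<circ> f) v = Lab i \<longleftrightarrow> v = Lab i"
  proof (intro ballI allI)
    fix v i assume v: "v \<in> \<Union>E"
    then have fv: "f v \<in> \<Union>F" unfolding U by (rule imageI)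
    show "(g \<circ> f) v = Lab i \<longleftrightarrow> v = Lab i"
      by (simp only: comp_apply pl_iso_via_Lab[OF assms(2) fv] pl_iso_via_Lab[OF assms(1) v])
  qed
  moreover have "G = (\<lambda>e. (g \<circ> f) ` e) ` E"
    unfolding pl_iso_via_edges[OF assms(2)] pl_iso_via_edges[OF assms(1)] image_image comp_def ..
  ultimately show ?thesis by (simp add: pl_iso_via_def)
qed

lemma pl_iso_via_inv:
  assumes "pl_iso_via f E F"
  shows "pl_iso_via (inv_into (\<Union>E) f) F E"
proof -
  let ?g = "inv_into (\<Union>E) f"
  have U: "\<Union>F = f ` \<Union>E" using assms by (rule pl_iso_via_Union)
  have inj: "inj_on f (\<Union>E)" using assms by (simp add: pl_iso_via_def)
  have gf: "?g (f v) = v" if "v \<in> \<Union>E" for v using inj that by (rule inv_into_f_f)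
  have "inj_on ?g (\<Union>F)" unfolding U by (rule inj_on_inv_into) simp
  moreover have "\<forall>w\<in>\<Union>F. \<forall>i. ?g w = Lab i \<longleftrightarrow> w = Lab i"
    unfolding U using assms gf by (simp add: pl_iso_via_def)
  moreover have "E = (\<lambda>e. ?g ` e) ` F"
  proof -
    have "?g ` f ` e = e" if "e \<in> E" for e
      using gf that by (force simp: image_image)
    then have "(\<lambda>e. ?g ` f ` e) ` E = (\<lambda>e. e) ` E" by (intro image_cong) auto
    then show ?thesis using assms by (simp add: pl_iso_via_def image_image)
  qed
  ultimately show ?thesis by (simp add: pl_iso_via_def)
qed

lemma pl_iso_via_id: "pl_iso_via id E E"
  by (simp add: pl_iso_via_def)

quotient_type plgraph = "vertex set set" / partial: pl_iso
proof (rule part_equivpI)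
  show "\<exists>E. pl_iso E E"
    using pl_iso_via_id by (intro exI[of _ "{}"]) (auto simp: pl_iso_def pl_edges_def)
  show "symp pl_iso"
    using pl_iso_via_inv by (force simp: symp_def pl_iso_def)
  show "transp pl_iso"
    using pl_iso_via_trans by (force simp: transp_def pl_iso_def)
qed

lift_definition empty_graph :: plgraph is "{}"
  using pl_iso_via_id by (auto simp: pl_iso_def pl_edges_def)

lift_definition num_edges :: "plgraph \<Rightarrow> nat" is card
proof -
  fix E F :: "vertex set set"
  assume "pl_iso E F"
  then obtain f where f: "pl_iso_via f E F" by (auto simp: pl_iso_def)
  have "inj_on (\<lambda>e. f ` e) E"
    using pl_iso_via_inj[OF f] by (rule inj_on_image)
  then show "card E = card F" using f by (simp add: pl_iso_via_def card_image)
qed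

lift_definition labels :: "plgraph \<Rightarrow> nat set" is "\<lambda>E. {i. Lab i \<in> \<Union>E}"
proof -
  fix E F :: "vertex set set"
  assume "pl_iso E F"
  then obtain f where f: "pl_iso_via f E F" by (auto simp: pl_iso_def)
  then have "\<Union>F = f ` \<Union>E" by (rule pl_iso_via_Union)
  moreover have "\<forall>v\<in>\<Union>E. \<forall>i. f v = Lab i \<longleftrightarrow> v = Lab i" using f by (simp add: pl_iso_via_def)
  ultimately show "{i. Lab i \<in> \<Union>E} = {i. Lab i \<in> \<Union>F}"
    by (metis (no_types, lifting) image_iff)
qed


subsection \<open>Gluing and unlabeling\<close>

fun tag0 :: "vertex \<Rightarrow> vertex" where
  "tag0 (Lab i) = Lab i"
| "tag0 (Unl j) = Unl (2 * j)"

fun tag1 :: "vertex \<Rightarrow> vertex" where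
  "tag1 (Lab i) = Lab i"
| "tag1 (Unl j) = Unl (2 * j + 1)"

definition glue_edges :: "vertex set set \<Rightarrow> vertex set set \<Rightarrow> vertex set set" where
  "glue_edges E F = (\<lambda>e. tag0 ` e) ` E \<union> (\<lambda>e. tag1 ` e) ` F"

fun unl :: "vertex \<Rightarrow> vertex" where
  "unl (Lab i) = Unl (2 * i)"
| "unl (Unl j) = Unl (2 * j + 1)"

lemma tag0_Lab: "tag0 v = Lab i \<longleftrightarrow> v = Lab i" by (cases v) auto
lemma tag1_Lab: "tag1 v = Lab i \<longleftrightarrow> v = Lab i" by (cases v) auto
lemma tag0_inj: "inj tag0" by (rule injI, rename_tac x y, case_tac x; case_tac y; simp)
lemma tag1_inj: "inj tag1" by (rule injI, rename_tac x y, case_tac x; case_tac y; simp)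
lemma unl_inj: "inj unl" by (rule injI, rename_tac x y, case_tac x; case_tac y; simp; presburger)

lemma tag0_eq_tag1: "tag0 v = tag1 w \<longleftrightarrow> (\<exists>i. v = Lab i \<and> w = Lab i)"
  by (cases v; cases w) (auto, presburger)

lemma pl_edges_glue:
  assumes "pl_edges E" "pl_edges F"
  shows "pl_edges (glue_edges E F)"
proof -
  have "card (tag0 ` e) = card e" "card (tag1 ` e) = card e" for e
    by (auto intro!: card_image inj_on_subset[OF tag0_inj] inj_on_subset[OF tag1_inj])
  then show ?thesis
    using assms tag0_Lab tag1_Lab unfolding pl_edges_def glue_edges_def by (force simp: eq_commute)
qed

lemma pl_edges_unl:
  assumes "pl_edges E"
  shows "pl_edges ((\<lambda>e. unl ` e) ` E)"
proof -
  have "card (unl ` e) = card e" for e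
    by (auto intro!: card_image inj_on_subset[OF unl_inj])
  moreover have "unl v \<noteq> Lab i" for v i by (cases v) auto
  ultimately show ?thesis
    using assms unfolding pl_edges_def by (force simp: eq_commute)
qed

lift_definition glue :: "plgraph \<Rightarrow> plgraph \<Rightarrow> plgraph" is glue_edges
proof -
  fix E E' F F' :: "vertex set set"
  assume EE: "pl_iso E E'" and FF: "pl_iso F F'"
  then obtain f g where f: "pl_iso_via f E E'" and g: "pl_iso_via g F F'"
    by (auto simp: pl_iso_def)
  define h where "h w = (if w \<in> tag0 ` \<Union>E then tag0 (f (inv tag0 w))
                         else tag1 (g (inv tag1 w)))" for w
  have flab: "f v = Lab i \<longleftrightarrow> v = Lab i" if "v \<in> \<Union>E" for v i
    using f that by (rule pl_iso_via_Lab)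
  have glab: "g v = Lab i \<longleftrightarrow> v = Lab i" if "v \<in> \<Union>F" for v i
    using g that by (rule pl_iso_via_Lab)
  have h0: "h (tag0 v) = tag0 (f v)" if "v \<in> \<Union>E" for v
    using imageI[OF that, of tag0] by (simp only: h_def if_P inv_f_f[OF tag0_inj])
  have h1: "h (tag1 v) = tag1 (g v)" if v: "v \<in> \<Union>F" for v
  proof (cases "tag1 v \<in> tag0 ` \<Union>E")
    case True
    then obtain u where u: "u \<in> \<Union>E" "tag0 u = tag1 v" by force
    then obtain i where "u = Lab i" "v = Lab i" using tag0_eq_tag1 by blast
    then have "f u = Lab i" "g v = Lab i" using flab[OF u(1)] glab[OF v] by blast+
    then show ?thesis using h0[OF u(1)] u(2) by simp
  next
    case False
    then show ?thesis by (simp only: h_def if_False inv_f_f[OF tag1_inj])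
  qed
  have U: "\<Union>(glue_edges E F) = tag0 ` \<Union>E \<union> tag1 ` \<Union>F"
    by (auto simp: glue_edges_def)
  have injf: "inj_on f (\<Union>E)" and injg: "inj_on g (\<Union>F)"
    using f g by (simp_all add: pl_iso_via_def)
  have cross: "tag0 u = tag1 w" if "u \<in> \<Union>E" "w \<in> \<Union>F" "h (tag0 u) = h (tag1 w)" for u w
  proof -
    have "tag0 (f u) = tag1 (g w)" using that h0 h1 by simp
    then obtain i where "f u = Lab i" "g w = Lab i" using tag0_eq_tag1 by blast
    then have "u = Lab i" "w = Lab i" using that flab glab by auto
    then show ?thesis by simp
  qed
  have "inj_on h (\<Union>(glue_edges E F))"
  proof (rule inj_onI)
    fix x y assume x: "x \<in> \<Union>(glue_edges E F)" and y: "y \<in> \<Union>(glue_edges E F)" and e: "h x = h y"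
    have same0: "tag0 u = tag0 w" if "u \<in> \<Union>E" "w \<in> \<Union>E" "h (tag0 u) = h (tag0 w)" for u w
      using that h0 injD[OF tag0_inj] inj_onD[OF injf] by metis
    have same1: "tag1 u = tag1 w" if "u \<in> \<Union>F" "w \<in> \<Union>F" "h (tag1 u) = h (tag1 w)" for u w
      using that h1 injD[OF tag1_inj] inj_onD[OF injg] by metis
    from x y e show "x = y"
      unfolding U using same0 same1 cross by (elim UnE imageE) metis+
  qed
  moreover have "\<forall>v\<in>\<Union>(glue_edges E F). \<forall>i. h v = Lab i \<longleftrightarrow> v = Lab i"
  proof (intro ballI allI)
    fix v i assume "v \<in> \<Union>(glue_edges E F)"
    then consider u where "u \<in> \<Union>E" "v = tag0 u" | u where "u \<in> \<Union>F" "v = tag1 u"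
      unfolding U by blast
    then show "h v = Lab i \<longleftrightarrow> v = Lab i"
    proof cases
      case 1
      show ?thesis by (simp only: 1(2) h0[OF 1(1)] tag0_Lab flab[OF 1(1)])
    next
      case 2
      show ?thesis by (simp only: 2(2) h1[OF 2(1)] tag1_Lab glab[OF 2(1)])
    qed
  qed
  moreover have "glue_edges E' F' = (\<lambda>e. h ` e) ` glue_edges E F"
  proof -
    have a: "h ` tag0 ` e = tag0 ` f ` e" if "e \<in> E" for e
      unfolding image_image using h0 that by (intro image_cong) auto
    have b: "h ` tag1 ` e = tag1 ` g ` e" if "e \<in> F" for e
      unfolding image_image using h1 that by (intro image_cong) auto
    have "(\<lambda>e. h ` e) ` glue_edges E F = (\<lambda>e. h ` tag0 ` e) ` E \<union> (\<lambda>e. h ` tag1 ` e) ` F"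
      by (simp add: glue_edges_def image_Un image_image)
    also have "\<dots> = (\<lambda>e. tag0 ` f ` e) ` E \<union> (\<lambda>e. tag1 ` g ` e) ` F"
      by (intro arg_cong2[where f = "(\<union>)"] image_cong[OF refl a] image_cong[OF refl b])
    also have "\<dots> = glue_edges E' F'"
      unfolding pl_iso_via_edges[OF f] pl_iso_via_edges[OF g] glue_edges_def image_image ..
    finally show ?thesis by simp
  qed
  ultimately have "pl_iso_via h (glue_edges E F) (glue_edges E' F')"
    by (simp add: pl_iso_via_def)
  then show "pl_iso (glue_edges E F) (glue_edges E' F')"
    using EE FF pl_edges_glue by (auto simp: pl_iso_def)
qed

lift_definition unlabel :: "plgraph \<Rightarrow> plgraph" is "\<lambda>E. (\<lambda>e. unl ` e) ` E"
proof -
  fix E F :: "vertex set set"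
  assume EF: "pl_iso E F"
  then obtain f where f: "pl_iso_via f E F" by (auto simp: pl_iso_def)
  define h where "h w = unl (f (inv unl w))" for w
  have h: "h (unl v) = unl (f v)" for v using unl_inj by (simp add: h_def)
  have nl: "unl v \<noteq> Lab i" for v i by (cases v) auto
  have U: "\<Union>((\<lambda>e. unl ` e) ` E) = unl ` \<Union>E" by auto
  have "inj_on h (unl ` \<Union>E)"
    using comp_inj_on[OF pl_iso_via_inj[OF f] inj_on_subset[OF unl_inj subset_UNIV]]
    by (intro inj_on_imageI) (simp add: comp_def h)
  moreover have "\<forall>v\<in>unl ` \<Union>E. \<forall>i. h v = Lab i \<longleftrightarrow> v = Lab i"
    using h nl by auto
  moreover have "(\<lambda>e. unl ` e) ` F = (\<lambda>e. h ` e) ` (\<lambda>e. unl ` e) ` E"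
    using f by (simp add: pl_iso_via_def image_image h)
  ultimately have "pl_iso_via h ((\<lambda>e. unl ` e) ` E) ((\<lambda>e. unl ` e) ` F)"
    unfolding pl_iso_via_def U by blast
  then show "pl_iso ((\<lambda>e. unl ` e) ` E) ((\<lambda>e. unl ` e) ` F)"
    using EF pl_edges_unl by (auto simp: pl_iso_def)
qed


subsection \<open>Connectedness and connected components\<close>

definition reach :: "vertex set set \<Rightarrow> (vertex \<times> vertex) set" where
  "reach E = {(u, v). {u, v} \<in> E}\<^sup>*"

definition component_edges :: "vertex set set \<Rightarrow> vertex \<Rightarrow> vertex set set" where
  "component_edges E u = {e \<in> E. \<forall>w\<in>e. (u, w) \<in> reach E}"

lemma reach_iso:
  assumes "pl_iso_via f E F" "(u, v) \<in> reach E"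
  shows "(f u, f v) \<in> reach F"
  using assms(2) unfolding reach_def
proof (induction rule: rtrancl_induct)
  case (step y z)
  then have "f ` {y, z} \<in> F" unfolding pl_iso_via_edges[OF assms(1)] by blast
  then have "(f y, f z) \<in> {(u, v). {u, v} \<in> F}" by simp
  with step.IH show ?case by (simp add: rtrancl.rtrancl_into_rtrancl)
qed simp

lemma reach_iso_iff:
  assumes f: "pl_iso_via f E F" and u: "u \<in> \<Union>E" and v: "v \<in> \<Union>E"
  shows "(f u, f v) \<in> reach F \<longleftrightarrow> (u, v) \<in> reach E"
proof
  assume "(f u, f v) \<in> reach F"
  then have "(inv_into (\<Union>E) f (f u), inv_into (\<Union>E) f (f v)) \<in> reach E"
    by (rule reach_iso[OF pl_iso_via_inv[OF f]])
  then show "(u, v) \<in> reach E"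
    using f u v by (simp add: pl_iso_via_def inv_into_f_f del: Union_iff)
qed (rule reach_iso[OF f])

lemma component_edges_iso:
  assumes f: "pl_iso_via f E F" and u: "u \<in> \<Union>E"
  shows "component_edges F (f u) = (\<lambda>e. f ` e) ` component_edges E u"
proof -
  have "F = (\<lambda>e. f ` e) ` E" using f by (simp add: pl_iso_via_def)
  moreover have "(\<forall>w\<in>f ` e. (f u, w) \<in> reach F) \<longleftrightarrow> (\<forall>w\<in>e. (u, w) \<in> reach E)" if "e \<in> E" for e
    using reach_iso_iff[OF f u] that by blast
  ultimately show ?thesis unfolding component_edges_def by blast
qed

lift_definition connected_graph :: "plgraph \<Rightarrow> bool" is
  "\<lambda>E. \<forall>u\<in>\<Union>E. \<forall>v\<in>\<Union>E. (u, v) \<in> reach E"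
proof -
  fix E F :: "vertex set set"
  assume "pl_iso E F"
  then obtain f where f: "pl_iso_via f E F" by (auto simp: pl_iso_def)
  show "(\<forall>u\<in>\<Union>E. \<forall>v\<in>\<Union>E. (u, v) \<in> reach E) = (\<forall>u\<in>\<Union>F. \<forall>v\<in>\<Union>F. (u, v) \<in> reach F)"
    unfolding pl_iso_via_Union[OF f] using reach_iso_iff[OF f] by blast
qed

lift_definition graph_components :: "plgraph \<Rightarrow> plgraph multiset" is
  "\<lambda>E. image_mset abs_plgraph (mset_set (component_edges E ` \<Union>E))"
proof -
  fix E F :: "vertex set set"
  assume EF: "pl_iso E F"
  then obtain f where f: "pl_iso_via f E F" by (auto simp: pl_iso_def)
  let ?C = "component_edges E ` \<Union>E" and ?\<phi> = "\<lambda>c. (\<lambda>e. f ` e) ` c"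
  have sub: "c \<subseteq> E" if "c \<in> ?C" for c using that by (auto simp: component_edges_def)
  have "inj_on (\<lambda>e. f ` e) E"
    using pl_iso_via_inj[OF f] by (rule inj_on_image)
  then have inj: "inj_on ?\<phi> ?C"
    using sub by (intro inj_onI) (metis inj_on_image_eq_iff)
  have "component_edges F ` \<Union>F = ?\<phi> ` ?C"
    unfolding pl_iso_via_Union[OF f] image_image
    using component_edges_iso[OF f] by (intro image_cong) auto
  then have eq: "mset_set (component_edges F ` \<Union>F) = image_mset ?\<phi> (mset_set ?C)"
    using image_mset_mset_set[OF inj] by simp
  have abs: "abs_plgraph (?\<phi> c) = abs_plgraph c" if "c \<in> ?C" for c
  proof -
    have cE: "c \<subseteq> E" using sub that by blast
    then have "pl_iso_via f c (?\<phi> c)"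
      using f unfolding pl_iso_via_def by (meson Union_mono inj_on_subset subsetD)
    moreover have "?\<phi> c \<subseteq> F" using cE f by (auto simp: pl_iso_via_def)
    then have "pl_edges c" "pl_edges (?\<phi> c)"
      using EF cE unfolding pl_iso_def pl_edges_def by (meson Union_mono finite_subset subsetD)+
    ultimately have "pl_iso c (?\<phi> c)" by (auto simp: pl_iso_def)
    then show ?thesis by (rule Quotient3_rel_abs[OF Quotient3_plgraph, symmetric])
  qed
  have "image_mset abs_plgraph (mset_set ?C) = image_mset (\<lambda>c. abs_plgraph (?\<phi> c)) (mset_set ?C)"
  proof (rule image_mset_cong)
    fix c assume "c \<in># mset_set ?C"
    then have "c \<in> ?C" using elem_mset_set by (cases "finite ?C") fastforce+
    then show "abs_plgraph c = abs_plgraph (?\<phi> c)" using abs by simp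
  qed
  then show "image_mset abs_plgraph (mset_set ?C)
           = image_mset abs_plgraph (mset_set (component_edges F ` \<Union>F))"
    unfolding eq by (simp add: image_mset.compositionality comp_def)
qed


subsection \<open>Homomorphism densities\<close>

definition simple_graph :: "nat set \<Rightarrow> nat set set \<Rightarrow> bool" where
  "simple_graph W D \<longleftrightarrow> finite W \<and> W \<noteq> {} \<and> D \<subseteq> {e. e \<subseteq> W \<and> card e = 2}"

lift_definition hom_density :: "plgraph \<Rightarrow> nat set \<Rightarrow> nat set set \<Rightarrow> real" is
  "\<lambda>E W D. real (card {\<phi> \<in> \<Union>E \<rightarrow>\<^sub>E W. \<forall>e\<in>E. \<phi> ` e \<in> D}) / real (card (\<Union>E \<rightarrow>\<^sub>E W))"
proof (intro ext)
  fix E F :: "vertex set set" and W :: "nat set" and D :: "nat set set"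
  assume "pl_iso E F"
  then obtain f where f: "pl_iso_via f E F" by (auto simp: pl_iso_def)
  let ?r = "\<lambda>\<psi>. restrict (\<psi> \<circ> f) (\<Union>E)"
  have U: "\<Union>F = f ` \<Union>E" by (rule pl_iso_via_Union[OF f])
  have bij: "bij_betw f (\<Union>E) (\<Union>F)" using f U by (simp add: bij_betw_def pl_iso_via_def)
  have b: "bij_betw ?r (\<Union>F \<rightarrow>\<^sub>E W) (\<Union>E \<rightarrow>\<^sub>E W)"
  proof (rule bij_betw_byWitness[where f' = "\<lambda>\<phi>. restrict (\<phi> \<circ> inv_into (\<Union>E) f) (\<Union>F)"])
    have gf: "inv_into (\<Union>E) f (f v) = v" if "v \<in> \<Union>E" for v
      using bij that by (simp add: bij_betw_def inv_into_f_f del: Union_iff)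
    have fg: "f (inv_into (\<Union>E) f w) = w" "inv_into (\<Union>E) f w \<in> \<Union>E" if "w \<in> \<Union>F" for w
      using that unfolding U by (simp_all add: f_inv_into_f inv_into_into del: Union_iff UN_iff)
    have fv: "f v \<in> \<Union>F" if "v \<in> \<Union>E" for v using that unfolding U by (rule imageI)
    show "\<forall>\<psi>\<in>\<Union>F \<rightarrow>\<^sub>E W. restrict (?r \<psi> \<circ> inv_into (\<Union>E) f) (\<Union>F) = \<psi>"
      using fg by (auto simp: fun_eq_iff PiE_iff extensional_def simp del: Union_iff)
    show "\<forall>\<phi>\<in>\<Union>E \<rightarrow>\<^sub>E W. ?r (restrict (\<phi> \<circ> inv_into (\<Union>E) f) (\<Union>F)) = \<phi>"
      using gf fv by (auto simp: fun_eq_iff PiE_iff extensional_def simp del: Union_iff)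
    show "?r ` (\<Union>F \<rightarrow>\<^sub>E W) \<subseteq> \<Union>E \<rightarrow>\<^sub>E W"
      unfolding image_subset_iff restrict_PiE_iff comp_apply
      using fv by (blast dest: PiE_mem)
    show "(\<lambda>\<phi>. restrict (\<phi> \<circ> inv_into (\<Union>E) f) (\<Union>F)) ` (\<Union>E \<rightarrow>\<^sub>E W) \<subseteq> \<Union>F \<rightarrow>\<^sub>E W"
      unfolding image_subset_iff restrict_PiE_iff comp_apply
      using fg(2) by (blast dest: PiE_mem)
  qed
  have im: "?r \<psi> ` e = \<psi> ` f ` e" if "e \<in> E" for e \<psi>
    using that unfolding image_image by (intro image_cong) auto
  have iff: "(\<forall>e\<in>E. ?r \<psi> ` e \<in> D) \<longleftrightarrow> (\<forall>e\<in>F. \<psi> ` e \<in> D)" for \<psi>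
    unfolding pl_iso_via_edges[OF f] by (simp only: ball_simps(9) im cong: ball_cong)
  have "bij_betw ?r {\<psi> \<in> \<Union>F \<rightarrow>\<^sub>E W. \<forall>e\<in>F. \<psi> ` e \<in> D} {\<phi> \<in> \<Union>E \<rightarrow>\<^sub>E W. \<forall>e\<in>E. \<phi> ` e \<in> D}"
  proof (rule bij_betw_subset[OF b])
    have "{\<phi> \<in> \<Union>E \<rightarrow>\<^sub>E W. \<forall>e\<in>E. \<phi> ` e \<in> D} = {\<phi> \<in> ?r ` (\<Union>F \<rightarrow>\<^sub>E W). \<forall>e\<in>E. \<phi> ` e \<in> D}"
      unfolding bij_betw_imp_surj_on[OF b] ..
    also have "\<dots> = ?r ` {\<psi> \<in> \<Union>F \<rightarrow>\<^sub>E W. \<forall>e\<in>E. ?r \<psi> ` e \<in> D}"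
      by (rule Compr_image_eq)
    finally show "?r ` {\<psi> \<in> \<Union>F \<rightarrow>\<^sub>E W. \<forall>e\<in>F. \<psi> ` e \<in> D} = {\<phi> \<in> \<Union>E \<rightarrow>\<^sub>E W. \<forall>e\<in>E. \<phi> ` e \<in> D}"
      unfolding iff by (rule sym)
  qed auto
  from bij_betw_same_card[OF this] bij_betw_same_card[OF b]
  show "real (card {\<phi> \<in> \<Union>E \<rightarrow>\<^sub>E W. \<forall>e\<in>E. \<phi> ` e \<in> D}) / real (card (\<Union>E \<rightarrow>\<^sub>E W))
      = real (card {\<phi> \<in> \<Union>F \<rightarrow>\<^sub>E W. \<forall>e\<in>F. \<phi> ` e \<in> D}) / real (card (\<Union>F \<rightarrow>\<^sub>E W))"
    by simp
qed


section \<open>Graph combinations and sums of squares\<close>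

type_synonym graph_comb = "plgraph \<Rightarrow>\<^sub>0 real"

definition comb_mult :: "graph_comb \<Rightarrow> graph_comb \<Rightarrow> graph_comb" where
  "comb_mult a b = (\<Sum>A\<in>Poly_Mapping.keys a. \<Sum>B\<in>Poly_Mapping.keys b.
     Poly_Mapping.single (glue A B) (Poly_Mapping.lookup a A * Poly_Mapping.lookup b B))"

definition comb_unlabel :: "graph_comb \<Rightarrow> graph_comb" where
  "comb_unlabel a =
     (\<Sum>A\<in>Poly_Mapping.keys a. Poly_Mapping.single (unlabel A) (Poly_Mapping.lookup a A))"

definition sos_comb :: "graph_comb list \<Rightarrow> graph_comb" where
  "sos_comb bs = (\<Sum>b\<leftarrow>bs. comb_unlabel (comb_mult b b))"

definition is_sos :: "nat \<Rightarrow> graph_comb \<Rightarrow> bool" where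
  "is_sos d a \<longleftrightarrow>
     (\<exists>bs. (\<forall>b\<in>set bs. \<forall>H\<in>Poly_Mapping.keys b. num_edges H \<le> d) \<and> a = sos_comb bs)"

definition label_bound :: "nat \<Rightarrow> nat \<Rightarrow> bool" where
  "label_bound d l \<longleftrightarrow> (\<forall>a. is_sos d a \<longrightarrow>
     (\<exists>bs. (\<forall>b\<in>set bs. \<forall>H\<in>Poly_Mapping.keys b. num_edges H \<le> d \<and> labels H \<subseteq> {1..l})
         \<and> a = sos_comb bs))"

definition basis :: "nat \<Rightarrow> nat \<Rightarrow> plgraph set" where
  "basis d l = insert empty_graph {A. num_edges A \<le> d \<and> labels A \<subseteq> {1..l}}"

definition reduced_basis :: "nat \<Rightarrow> nat \<Rightarrow> plgraph set" where
  "reduced_basis d l =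
     insert empty_graph {A \<in> basis d l. \<forall>C\<in>#graph_components A. labels C \<noteq> {}}"

definition variables :: "nat \<Rightarrow> nat \<Rightarrow> plgraph set" where
  "variables d l = {unlabel (glue A B) | A B.
     A \<in> basis d l \<and> B \<in> basis d l \<and> connected_graph (unlabel (glue A B))} - {empty_graph}"

text \<open>
  A monomial in the variables \<open>x\<^sub>C\<close> is the multiset of its factors. The space \<open>\<real>\<^sup>V\<close> for a finite set \<open>V\<close>
  of graphs is \<open>V \<rightarrow>\<^sub>E UNIV\<close>, with the topology \<open>powertop_real V\<close>.
\<close>

definition eval_monomial :: "plgraph multiset \<Rightarrow> (plgraph \<Rightarrow> real) \<Rightarrow> real" where
  "eval_monomial m v = (\<Prod>C\<in>#m. v C)"

definition eval_comb :: "graph_comb \<Rightarrow> (plgraph \<Rightarrow> real) \<Rightarrow> real" where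
  "eval_comb a v = (\<Sum>H\<in>Poly_Mapping.keys a.
     Poly_Mapping.lookup a H * eval_monomial (graph_components H) v)"

definition nonneg_orthant :: "plgraph set \<Rightarrow> (plgraph \<Rightarrow> real) set" where
  "nonneg_orthant V = V \<rightarrow>\<^sub>E {0..}"

definition pos_orthant :: "plgraph set \<Rightarrow> (plgraph \<Rightarrow> real) set" where
  "pos_orthant V = V \<rightarrow>\<^sub>E {0<..}"

definition sos_profile :: "nat \<Rightarrow> nat \<Rightarrow> (plgraph \<Rightarrow> real) set" where
  "sos_profile d l =
     {v \<in> nonneg_orthant (variables d l). \<forall>a. is_sos d a \<longrightarrow> eval_comb a v \<ge> 0}"

definition graph_profile :: "plgraph set \<Rightarrow> (plgraph \<Rightarrow> real) set" where
  "graph_profile V =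
     powertop_real V closure_of {(\<lambda>C\<in>V. hom_density C W D) | W D. simple_graph W D}"

definition moment_matrix :: "plgraph \<Rightarrow> plgraph \<Rightarrow> plgraph multiset" where
  "moment_matrix A B = graph_components (unlabel (glue A B))"

definition minors22 ::
  "plgraph set \<Rightarrow> 'i set \<Rightarrow> ('i \<Rightarrow> 'i \<Rightarrow> plgraph multiset) \<Rightarrow> (plgraph \<Rightarrow> real) set" where
  "minors22 V I M = {v \<in> nonneg_orthant V. \<forall>i\<in>I. \<forall>j\<in>I. i \<noteq> j \<longrightarrow>
     eval_monomial (M i i) v * eval_monomial (M j j) v
       - eval_monomial (M i j) v * eval_monomial (M j i) v \<ge> 0}"


section \<open>Semialgebraic sets, tropicalization and rational cones\<close>

text \<open>A polynomial over \<open>\<real>\<close> is a finitely supported map from exponent vectors to coefficients.\<close>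

definition eval_poly :: "(('v \<Rightarrow>\<^sub>0 nat) \<Rightarrow>\<^sub>0 real) \<Rightarrow> ('v \<Rightarrow> real) \<Rightarrow> real" where
  "eval_poly p v = (\<Sum>m\<in>Poly_Mapping.keys p. Poly_Mapping.lookup p m *
     (\<Prod>x\<in>Poly_Mapping.keys m. v x ^ Poly_Mapping.lookup m x))"

definition basic_semialgebraic :: "plgraph set \<Rightarrow> (plgraph \<Rightarrow> real) set \<Rightarrow> bool" where
  "basic_semialgebraic V S \<longleftrightarrow> (\<exists>P. finite P
     \<and> (\<forall>p\<in>P. \<forall>m\<in>Poly_Mapping.keys p. Poly_Mapping.keys m \<subseteq> V)
     \<and> S = {v \<in> nonneg_orthant V. \<forall>p\<in>P. eval_poly p v \<ge> 0})"

definition log_set :: "plgraph set \<Rightarrow> (plgraph \<Rightarrow> real) set \<Rightarrow> (plgraph \<Rightarrow> real) set" where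
  "log_set V S = (\<lambda>v. \<lambda>C\<in>V. ln (v C)) ` (S \<inter> pos_orthant V)"

definition trop :: "plgraph set \<Rightarrow> (plgraph \<Rightarrow> real) set \<Rightarrow> (plgraph \<Rightarrow> real) set" where
  "trop V S = {y. \<exists>(\<tau> :: nat \<Rightarrow> real) w.
     (\<forall>k. \<tau> k \<in> {0<..<1}) \<and> \<tau> \<longlonglongrightarrow> 0 \<and> (\<forall>k. w k \<in> S \<inter> pos_orthant V)
     \<and> limitin (powertop_real V) (\<lambda>k. \<lambda>C\<in>V. (- 1 / ln (\<tau> k)) * ln (w k C)) y sequentially}"

definition rational_polyhedral_cone :: "plgraph set \<Rightarrow> (plgraph \<Rightarrow> real) set \<Rightarrow> bool" where
  "rational_polyhedral_cone V K \<longleftrightarrow> (\<exists>F :: (plgraph \<Rightarrow> rat) set. finite F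
     \<and> K = {y \<in> V \<rightarrow>\<^sub>E UNIV. \<forall>c\<in>F. (\<Sum>C\<in>V. of_rat (c C) * y C) \<ge> 0})"

end

theory Submission
  imports Defs
begin

text \<open>
  Splitting off unlabeled components is a congruence of the moment matrix, so the sums-of-squares
  profile consists of the nonnegative points at which the matrix \<open>M\<close> indexed by the reduced basis is
  positive semidefinite. For the density vector of a graph, \<open>M\<close> is an average of rank one matrices
  over all placements of the labels, which puts the graph profile inside.

  The \<open>2 \<times> 2\<close> minors of \<open>M\<close> are binomials, so their logarithms cut out a rational cone containing
  the tropicalization. Conversely, if all the inequalities of the cone are strict at \<open>y\<close>, then for
  large \<open>s\<close> the matrix \<open>M\<close> at \<open>exp (s y)\<close> is, after scaling the diagonal to 1, close to the identity,
  hence positive definite. It remains to find one strict point. For two distinct graphs \<open>A\<close>, \<open>B\<close> of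
  the reduced basis the logarithm of the density in a looped graph \<open>G\<close> works, unless the numbers of
  homomorphisms to \<open>G\<close> with prescribed labels are proportional for \<open>A\<close> and \<open>B\<close>. Adding an isolated
  looped vertex to \<open>G\<close> forces the factor 1, and by Lovasz' argument equality for all \<open>G\<close> would make
  \<open>A\<close> and \<open>B\<close> isomorphic. The sum of these logarithms over all pairs is strict everywhere.
\<close>


section \<open>Positive semidefinite matrices\<close>

definition quadratic_form :: "'i set \<Rightarrow> ('i \<Rightarrow> 'i \<Rightarrow> real) \<Rightarrow> ('i \<Rightarrow> real) \<Rightarrow> real" where
  "quadratic_form I M x = (\<Sum>i\<in>I. \<Sum>j\<in>I. x i * x j * M i j)"

definition psd_on :: "'i set \<Rightarrow> ('i \<Rightarrow> 'i \<Rightarrow> real) \<Rightarrow> bool" where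
  "psd_on I M \<longleftrightarrow> (\<forall>x. quadratic_form I M x \<ge> 0)"

definition symmetric_on :: "'i set \<Rightarrow> ('i \<Rightarrow> 'i \<Rightarrow> 'b) \<Rightarrow> bool" where
  "symmetric_on I M \<longleftrightarrow> (\<forall>i\<in>I. \<forall>j\<in>I. M i j = M j i)"

lemma psd_onI: "(\<And>x. quadratic_form I M x \<ge> 0) \<Longrightarrow> psd_on I M"
  by (simp add: psd_on_def)

lemma psd_onD: "psd_on I M \<Longrightarrow> quadratic_form I M x \<ge> 0"
  by (simp add: psd_on_def)

lemma symmetric_onD: "symmetric_on I M \<Longrightarrow> i \<in> I \<Longrightarrow> j \<in> I \<Longrightarrow> M i j = M j i"
  by (simp add: symmetric_on_def)

lemma quadratic_form_cong:
  "(\<And>i. i \<in> I \<Longrightarrow> x i = y i) \<Longrightarrow> (\<And>i j. i \<in> I \<Longrightarrow> j \<in> I \<Longrightarrow> M i j = N i j)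
    \<Longrightarrow> quadratic_form I M x = quadratic_form I N y"
  by (simp add: quadratic_form_def cong: sum.cong)

lemma psd_on_cong:
  "(\<And>i j. i \<in> I \<Longrightarrow> j \<in> I \<Longrightarrow> M i j = N i j) \<Longrightarrow> psd_on I M \<longleftrightarrow> psd_on I N"
  unfolding psd_on_def using quadratic_form_cong[of I _ _ M N] by metis

lemma quadratic_form_superset:
  assumes "finite I" "J \<subseteq> I" "\<And>i. i \<in> I - J \<Longrightarrow> x i = 0"
  shows "quadratic_form I M x = quadratic_form J M x"
proof -
  have "(\<Sum>j\<in>I. x i * x j * M i j) = (\<Sum>j\<in>J. x i * x j * M i j)" for i
    using assms by (intro sum.mono_neutral_right) auto
  then show ?thesis
    unfolding quadratic_form_def using assms
    by (simp, intro sum.mono_neutral_right) auto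
qed

lemma psd_on_subset:
  assumes "finite I" "psd_on I M" "J \<subseteq> I"
  shows "psd_on J M"
proof (rule psd_onI)
  fix x :: "'a \<Rightarrow> real"
  let ?x = "\<lambda>i. if i \<in> J then x i else 0"
  have "quadratic_form I M ?x = quadratic_form J M ?x"
    by (rule quadratic_form_superset[OF assms(1,3)]) simp
  also have "\<dots> = quadratic_form J M x"
    by (rule quadratic_form_cong) simp_all
  finally show "quadratic_form J M x \<ge> 0"
    using psd_onD[OF assms(2)] by metis
qed

lemma psd_on_diag:
  assumes "finite I" "psd_on I M" "i \<in> I"
  shows "M i i \<ge> 0"
proof -
  have "psd_on {i} M" using assms by (auto intro: psd_on_subset)
  then show ?thesis
    using psd_onD[of "{i}" M "\<lambda>_. 1"] by (simp add: quadratic_form_def)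
qed

lemma psd_on_minor:
  assumes "finite I" "psd_on I M" "symmetric_on I M" and indices: "i \<in> I" "j \<in> I" "i \<noteq> j"
  shows "(M i j)\<^sup>2 \<le> M i i * M j j"
proof -
  have psd_pair: "psd_on {i, j} M" using assms by (auto intro: psd_on_subset)
  have form_nonneg: "a\<^sup>2 * M i i + 2 * a * b * M i j + b\<^sup>2 * M j j \<ge> 0" for a b
  proof -
    have "quadratic_form {i, j} M ((\<lambda>_. b)(i := a)) = a\<^sup>2 * M i i + 2 * a * b * M i j + b\<^sup>2 * M j j"
      using indices symmetric_onD[OF assms(3) indices(2,1)]
      by (simp add: quadratic_form_def power2_eq_square algebra_simps)
    then show ?thesis using psd_onD[OF psd_pair] by metis
  qed
  have "M i i * (M i i * M j j - (M i j)\<^sup>2) \<ge> 0" "M j j * (M i i * M j j - (M i j)\<^sup>2) \<ge> 0"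
    using form_nonneg[of "- M i j" "M i i"] form_nonneg[of "M j j" "- M i j"]
    by (simp_all add: power2_eq_square algebra_simps)
  moreover have "M i i = 0 \<Longrightarrow> M j j = 0 \<Longrightarrow> M i j = 0"
    using form_nonneg[of "- M i j" 1] by (auto simp: mult_le_0_iff)
  moreover have "M i i > 0 \<or> M j j > 0 \<or> M i i = 0 \<and> M j j = 0"
    using psd_on_diag[OF assms(1,2) indices(1)] psd_on_diag[OF assms(1,2) indices(2)] by linarith
  ultimately show ?thesis
    by (auto simp: zero_le_mult_iff)
qed

text \<open>The usual Schur complement is multiplied by the pivot, so it stays polynomial in the entries.\<close>

definition schur_complement :: "('i \<Rightarrow> 'i \<Rightarrow> real) \<Rightarrow> 'i \<Rightarrow> 'i \<Rightarrow> 'i \<Rightarrow> real" where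
  "schur_complement M i j k = M i i * M j k - M i j * M i k"

lemma quadratic_form_schur_complement:
  "quadratic_form J (schur_complement M i) x = M i i * quadratic_form J M x - (\<Sum>j\<in>J. x j * M i j)\<^sup>2"
proof -
  have "quadratic_form J (schur_complement M i) x =
      (\<Sum>j\<in>J. \<Sum>k\<in>J. M i i * (x j * x k * M j k) - (x j * M i j) * (x k * M i k))"
    unfolding quadratic_form_def schur_complement_def
    by (intro sum.cong refl) (simp add: algebra_simps)
  then show ?thesis
    unfolding quadratic_form_def power2_eq_square sum_product
    by (simp only: sum_subtractf sum_distrib_left)
qed

lemma quadratic_form_complete_square:
  assumes "finite I" "i \<in> I" "symmetric_on I M"
  shows "M i i * quadratic_form I M x =
    (M i i * x i + (\<Sum>j\<in>I-{i}. x j * M i j))\<^sup>2 + quadratic_form (I - {i}) (schur_complement M i) x"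
proof -
  let ?b = "\<Sum>j\<in>I-{i}. x j * M i j"
  have "(\<Sum>j\<in>I-{i}. x j * x i * M j i) = x i * ?b"
    unfolding sum_distrib_left
    by (rule sum.cong) (auto simp: symmetric_onD[OF assms(3) _ assms(2)])
  moreover have "(\<Sum>j\<in>I-{i}. x i * x j * M i j) = x i * ?b"
    unfolding sum_distrib_left by (rule sum.cong) auto
  ultimately have "quadratic_form I M x = M i i * (x i)\<^sup>2 + 2 * x i * ?b + quadratic_form (I - {i}) M x"
    using assms(1,2)
    by (simp add: quadratic_form_def sum.remove[of I i] sum.distrib algebra_simps power2_eq_square)
  then show ?thesis
    unfolding quadratic_form_schur_complement by (simp add: power2_eq_square algebra_simps)
qed

lemma psd_on_schur_complement:
  assumes "finite I" "psd_on I M" "symmetric_on I M" "i \<in> I"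
  shows "psd_on (I - {i}) (schur_complement M i)"
proof (rule psd_onI)
  fix x :: "'a \<Rightarrow> real"
  let ?b = "\<Sum>j\<in>I-{i}. x j * M i j"
  consider (zero) "M i i = 0" | (pos) "M i i > 0" using psd_on_diag[OF assms(1,2,4)] by fastforce
  then show "quadratic_form (I - {i}) (schur_complement M i) x \<ge> 0"
  proof cases
    case zero
    then have "M i j = 0" if "j \<in> I - {i}" for j
      using psd_on_minor[OF assms(1-4), of j] that by fastforce
    then show ?thesis using zero by (simp add: quadratic_form_def schur_complement_def)
  next
    case pos
    let ?x = "x(i := - ?b / M i i)"
    have "(\<Sum>j\<in>I-{i}. ?x j * M i j) = ?b" by (rule sum.cong) auto
    then have "M i i * quadratic_form I M ?x = quadratic_form (I - {i}) (schur_complement M i) ?x"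
      using quadratic_form_complete_square[OF assms(1,4,3), of ?x] pos by simp
    also have "\<dots> = quadratic_form (I - {i}) (schur_complement M i) x"
      by (rule quadratic_form_cong) auto
    finally show ?thesis using pos psd_onD[OF assms(2), of ?x] by (metis less_imp_le mult_nonneg_nonneg)
  qed
qed

lemma psd_on_of_schur_complement:
  assumes "finite I" "i \<in> I" "symmetric_on I M" "M i i > 0"
    and "psd_on (I - {i}) (schur_complement M i)"
  shows "psd_on I M"
proof (rule psd_onI)
  fix x
  have "M i i * quadratic_form I M x \<ge> 0"
    using quadratic_form_complete_square[OF assms(1-3), of x] psd_onD[OF assms(5), of x] by simp
  then show "quadratic_form I M x \<ge> 0" using assms(4) by (simp add: zero_le_mult_iff)
qed

lemma psd_on_iff_all_pivots:
  assumes "finite I" "symmetric_on I M"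
  shows "psd_on I M \<longleftrightarrow> (\<forall>i\<in>I. M i i \<ge> 0 \<and> psd_on (I - {i}) (schur_complement M i))"
    (is "_ \<longleftrightarrow> ?pivots")
proof
  assume "psd_on I M"
  then show ?pivots using assms by (simp add: psd_on_diag psd_on_schur_complement)
next
  assume pivots: ?pivots
  show "psd_on I M"
  proof (cases "\<exists>i\<in>I. M i i > 0")
    case True
    then obtain i where "i \<in> I" "M i i > 0" by blast
    then show ?thesis using pivots assms by (auto intro: psd_on_of_schur_complement)
  next
    case False
    then have diag_zero: "M i i = 0" if "i \<in> I" for i using pivots that by force
    have "M i j = 0" if "i \<in> I" "j \<in> I" for i j
    proof (cases "i = j")
      case False
      then have "schur_complement M i j j \<ge> 0"
        using psd_on_diag[of "I - {i}" "schur_complement M i" j] pivots assms(1) that by simp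
      then show ?thesis
        using diag_zero that by (auto simp: schur_complement_def mult_le_0_iff)
    qed (simp add: diag_zero that)
    then show ?thesis by (simp add: psd_on_def quadratic_form_def)
  qed
qed

lemma psd_on_Gram:
  assumes "c \<ge> 0"
  shows "psd_on I (\<lambda>i j. c * (\<Sum>a\<in>A. p i a * p j a))"
proof (rule psd_onI)
  fix x
  have "quadratic_form I (\<lambda>i j. c * (\<Sum>a\<in>A. p i a * p j a)) x =
      c * (\<Sum>i\<in>I. \<Sum>j\<in>I. \<Sum>a\<in>A. (x i * p i a) * (x j * p j a))"
    by (simp add: quadratic_form_def sum_distrib_left algebra_simps)
  also have "\<dots> = c * (\<Sum>i\<in>I. \<Sum>a\<in>A. \<Sum>j\<in>I. (x i * p i a) * (x j * p j a))"
    by (intro arg_cong2[where f = "(*)"] sum.cong refl sum.swap)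
  also have "\<dots> = c * (\<Sum>a\<in>A. \<Sum>i\<in>I. \<Sum>j\<in>I. (x i * p i a) * (x j * p j a))"
    by (intro arg_cong2[where f = "(*)"] refl sum.swap)
  also have "\<dots> = c * (\<Sum>a\<in>A. (\<Sum>i\<in>I. x i * p i a)\<^sup>2)"
    by (simp add: power2_eq_square sum_product)
  finally show "quadratic_form I (\<lambda>i j. c * (\<Sum>a\<in>A. p i a * p j a)) x \<ge> 0"
    using assms by (simp add: sum_nonneg)
qed

lemma psd_on_congruence:
  fixes M :: "'j \<Rightarrow> 'j \<Rightarrow> real"
  assumes "psd_on J M" "finite I" "finite J" "r ` I \<subseteq> J"
  shows "psd_on I (\<lambda>i k. u i * u k * M (r i) (r k))"
proof (rule psd_onI)
  fix x
  define z where "z p = (\<Sum>i\<in>{i \<in> I. r i = p}. x i * u i)" for p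
  have regroup: "(\<Sum>i\<in>I. x i * u i * f (r i)) = (\<Sum>p\<in>J. z p * f p)" for f
  proof -
    have "(\<Sum>i\<in>I. x i * u i * f (r i)) = (\<Sum>p\<in>J. \<Sum>i\<in>{i \<in> I. r i = p}. x i * u i * f (r i))"
      by (rule sum.group[symmetric, OF assms(2-4)])
    also have "\<dots> = (\<Sum>p\<in>J. z p * f p)"
      unfolding z_def sum_distrib_right by (intro sum.cong refl) auto
    finally show ?thesis .
  qed
  have "quadratic_form I (\<lambda>i k. u i * u k * M (r i) (r k)) x =
      (\<Sum>i\<in>I. x i * u i * (\<Sum>k\<in>I. x k * u k * M (r i) (r k)))"
    by (simp add: quadratic_form_def sum_distrib_left algebra_simps)
  also have "\<dots> = (\<Sum>p\<in>J. z p * (\<Sum>q\<in>J. z q * M p q))"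
    unfolding regroup by (rule regroup)
  also have "\<dots> = quadratic_form J M z"
    by (simp add: quadratic_form_def sum_distrib_left mult.assoc)
  finally show "quadratic_form I (\<lambda>i k. u i * u k * M (r i) (r k)) x \<ge> 0"
    using psd_onD[OF assms(1)] by simp
qed

lemma psd_on_diagonally_dominant:
  fixes M :: "'i \<Rightarrow> 'i \<Rightarrow> real"
  assumes "finite I"
    and diag: "\<And>i. i \<in> I \<Longrightarrow> M i i = (r i)\<^sup>2"
    and off_diag: "\<And>i j. i \<in> I \<Longrightarrow> j \<in> I \<Longrightarrow> i \<noteq> j \<Longrightarrow> \<bar>M i j\<bar> * card I \<le> r i * r j"
  shows "psd_on I M"
proof (rule psd_onI)
  fix x
  let ?n = "real (card I)" and ?z = "\<lambda>i. \<bar>x i\<bar> * r i"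
  have entrywise: "of_bool (i = j) * (?n * (?z i)\<^sup>2) - ?z i * ?z j \<le> ?n * (x i * x j * M i j)"
    if "i \<in> I" "j \<in> I" for i j
  proof (cases "i = j")
    case True
    then show ?thesis using diag that zero_le_square[of "r j * x j"]
      by (simp add: power2_eq_square algebra_simps)
  next
    case False
    have "\<bar>?n * (x i * x j * M i j)\<bar> = \<bar>x i * x j\<bar> * (\<bar>M i j\<bar> * ?n)"
      by (simp add: abs_mult)
    also have "\<dots> \<le> \<bar>x i * x j\<bar> * (r i * r j)"
      by (intro mult_left_mono off_diag that False) auto
    also have "\<dots> = ?z i * ?z j" by (simp add: abs_mult algebra_simps)
    finally show ?thesis using False by (simp add: abs_le_iff)
  qed
  have diag_sum: "(\<Sum>j\<in>I. of_bool (i = j) * (?n * (?z i)\<^sup>2)) = ?n * (?z i)\<^sup>2" if "i \<in> I" for i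
    using assms(1) that by (simp add: sum_distrib_right[symmetric] of_bool_def)
  have "0 \<le> ?n * (\<Sum>i\<in>I. (?z i)\<^sup>2) - (\<Sum>i\<in>I. ?z i)\<^sup>2"
    using sum_squared_le_sum_of_squares[of ?z I] by (simp add: mult.commute)
  also have "\<dots> = (\<Sum>i\<in>I. \<Sum>j\<in>I. of_bool (i = j) * (?n * (?z i)\<^sup>2) - ?z i * ?z j)"
    by (simp add: diag_sum sum_subtractf sum_product[symmetric] power2_eq_square[of "sum _ _"]
        sum_distrib_left del: power_mult_distrib)
  also have "\<dots> \<le> (\<Sum>i\<in>I. \<Sum>j\<in>I. ?n * (x i * x j * M i j))"
    by (intro sum_mono entrywise)
  also have "\<dots> = ?n * quadratic_form I M x"
    by (simp add: quadratic_form_def sum_distrib_left)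
  finally show "quadratic_form I M x \<ge> 0"
    using assms(1) by (cases "I = {}") (auto simp: quadratic_form_def zero_le_mult_iff card_gt_0_iff)
qed

lemma strict_Cauchy_Schwarz_sum:
  fixes p q :: "'i \<Rightarrow> real"
  assumes "finite I" "a \<in> I" "b \<in> I" "p a * q b \<noteq> p b * q a"
  shows "(\<Sum>i\<in>I. p i * q i)\<^sup>2 < (\<Sum>i\<in>I. p i * p i) * (\<Sum>i\<in>I. q i * q i)"
proof -
  have "0 < (p a * q b - p b * q a)\<^sup>2" using assms by simp
  also have "\<dots> \<le> (\<Sum>j\<in>I. (p a * q j - p j * q a)\<^sup>2)"
    by (rule member_le_sum[of b]) (use assms in auto)
  also have "\<dots> \<le> (\<Sum>i\<in>I. \<Sum>j\<in>I. (p i * q j - p j * q i)\<^sup>2)"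
    by (rule member_le_sum[of a]) (use assms in \<open>auto intro: sum_nonneg\<close>)
  also have "\<dots> = (\<Sum>i\<in>I. \<Sum>j\<in>I. (p i * p i) * (q j * q j)) + (\<Sum>i\<in>I. \<Sum>j\<in>I. (q i * q i) * (p j * p j))
      - 2 * (\<Sum>i\<in>I. \<Sum>j\<in>I. (p i * q i) * (p j * q j))"
    unfolding sum_distrib_left sum.distrib[symmetric] sum_subtractf[symmetric]
    by (intro sum.cong refl) (simp add: power2_eq_square algebra_simps)
  also have "\<dots> = 2 * ((\<Sum>i\<in>I. p i * p i) * (\<Sum>i\<in>I. q i * q i) - (\<Sum>i\<in>I. p i * q i)\<^sup>2)"
    unfolding sum_product[symmetric] power2_eq_square by simp
  finally show ?thesis by simp
qed


section \<open>Polynomial inequalities\<close>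

definition linear_extension :: "('a \<Rightarrow> real) \<Rightarrow> ('a \<Rightarrow>\<^sub>0 real) \<Rightarrow> real" where
  "linear_extension f p = (\<Sum>k\<in>Poly_Mapping.keys p. Poly_Mapping.lookup p k * f k)"

lemma linear_extension_zero: "linear_extension f 0 = 0"
  by (simp add: linear_extension_def)

lemma linear_extension_add: "linear_extension f (p + q) = linear_extension f p + linear_extension f q"
  unfolding linear_extension_def
  by (rule Poly_Mapping.setsum_keys_plus_distrib[where f = "\<lambda>k c. c * f k"]) (simp_all add: algebra_simps)

lemma linear_extension_single: "linear_extension f (Poly_Mapping.single k c) = c * f k"
  by (simp add: linear_extension_def)

lemma linear_extension_sum: "linear_extension f (\<Sum>i\<in>I. p i) = (\<Sum>i\<in>I. linear_extension f (p i))"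
  by (induction I rule: infinite_finite_induct) (simp_all add: linear_extension_add linear_extension_zero)

definition power_product :: "('v \<Rightarrow>\<^sub>0 nat) \<Rightarrow> ('v \<Rightarrow> real) \<Rightarrow> real" where
  "power_product m v = (\<Prod>x\<in>Poly_Mapping.keys m. v x ^ Poly_Mapping.lookup m x)"

lemma power_product_superset:
  assumes "finite X" "Poly_Mapping.keys m \<subseteq> X"
  shows "power_product m v = (\<Prod>x\<in>X. v x ^ Poly_Mapping.lookup m x)"
  unfolding power_product_def
  by (rule prod.mono_neutral_left) (use assms in \<open>auto simp: in_keys_iff\<close>)

lemma power_product_add: "power_product (m + m') v = power_product m v * power_product m' v"
  using power_product_superset[of "Poly_Mapping.keys m \<union> Poly_Mapping.keys m'"]
    Poly_Mapping.keys_add[of m m']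
  by (simp add: lookup_add power_add prod.distrib)

lemma eval_poly_eq_linear_extension: "eval_poly p v = linear_extension (\<lambda>m. power_product m v) p"
  by (simp add: eval_poly_def linear_extension_def power_product_def)

definition polynomial_fun :: "'v set \<Rightarrow> (('v \<Rightarrow> real) \<Rightarrow> real) \<Rightarrow> bool" where
  "polynomial_fun V f \<longleftrightarrow>
     (\<exists>p. (\<forall>m\<in>Poly_Mapping.keys p. Poly_Mapping.keys m \<subseteq> V) \<and> f = eval_poly p)"

lemma polynomial_fun_add:
  assumes "polynomial_fun V f" "polynomial_fun V g"
  shows "polynomial_fun V (\<lambda>v. f v + g v)"
proof -
  from assms obtain p q
    where "\<forall>m\<in>Poly_Mapping.keys p \<union> Poly_Mapping.keys q. Poly_Mapping.keys m \<subseteq> V"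
      and "f = eval_poly p" "g = eval_poly q"
    unfolding polynomial_fun_def by blast
  then show ?thesis
    unfolding polynomial_fun_def using Poly_Mapping.keys_add[of p q]
    by (intro exI[of _ "p + q"]) (auto simp: eval_poly_eq_linear_extension linear_extension_add)
qed

lemma polynomial_fun_term:
  "Poly_Mapping.keys m \<subseteq> V \<Longrightarrow> polynomial_fun V (\<lambda>v. c * power_product m v)"
  unfolding polynomial_fun_def eval_poly_eq_linear_extension[abs_def]
  by (intro exI[of _ "Poly_Mapping.single m c"]) (simp add: linear_extension_single)

lemma polynomial_fun_const: "polynomial_fun V (\<lambda>v. c)"
  using polynomial_fun_term[of 0 V c] by (simp add: power_product_def)

lemma polynomial_fun_var: "x \<in> V \<Longrightarrow> polynomial_fun V (\<lambda>v. v x)"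
  using polynomial_fun_term[of "Poly_Mapping.single x 1" V 1] by (simp add: power_product_def)

lemma polynomial_fun_sum:
  "(\<And>i. i \<in> I \<Longrightarrow> polynomial_fun V (f i)) \<Longrightarrow> polynomial_fun V (\<lambda>v. \<Sum>i\<in>I. f i v)"
  by (induction I rule: infinite_finite_induct) (auto intro: polynomial_fun_const polynomial_fun_add)

lemma polynomial_fun_mult:
  assumes "polynomial_fun V f" "polynomial_fun V g"
  shows "polynomial_fun V (\<lambda>v. f v * g v)"
proof -
  from assms obtain p q
    where vars: "\<And>m. m \<in> Poly_Mapping.keys p \<union> Poly_Mapping.keys q \<Longrightarrow> Poly_Mapping.keys m \<subseteq> V"
      and polys: "f = eval_poly p" "g = eval_poly q"
    unfolding polynomial_fun_def by blast
  have "f v * g v = (\<Sum>m\<in>Poly_Mapping.keys p. \<Sum>m'\<in>Poly_Mapping.keys q.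
      (Poly_Mapping.lookup p m * Poly_Mapping.lookup q m') * power_product (m + m') v)" for v
    by (simp add: polys eval_poly_eq_linear_extension linear_extension_def sum_product power_product_add
        algebra_simps)
  moreover have "Poly_Mapping.keys (m + m') \<subseteq> V"
    if "m \<in> Poly_Mapping.keys p" "m' \<in> Poly_Mapping.keys q" for m m'
    using vars[of m] vars[of m'] that Poly_Mapping.keys_add[of m m'] by blast
  ultimately show ?thesis
    by (auto intro!: polynomial_fun_sum polynomial_fun_term)
qed

lemma polynomial_fun_diff:
  assumes "polynomial_fun V f" "polynomial_fun V g"
  shows "polynomial_fun V (\<lambda>v. f v - g v)"
  using polynomial_fun_add[OF assms(1) polynomial_fun_mult[OF polynomial_fun_const[of V "-1"] assms(2)]]
  by simp

definition polynomial_condition :: "'v set \<Rightarrow> (('v \<Rightarrow> real) \<Rightarrow> bool) \<Rightarrow> bool" where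
  "polynomial_condition V P \<longleftrightarrow>
     (\<exists>F. finite F \<and> (\<forall>f\<in>F. polynomial_fun V f) \<and> (\<forall>v. P v \<longleftrightarrow> (\<forall>f\<in>F. f v \<ge> 0)))"

lemma polynomial_condition_nonneg: "polynomial_fun V f \<Longrightarrow> polynomial_condition V (\<lambda>v. f v \<ge> 0)"
  unfolding polynomial_condition_def by (intro exI[of _ "{f}"]) simp

lemma polynomial_condition_conj:
  assumes "polynomial_condition V P" "polynomial_condition V Q"
  shows "polynomial_condition V (\<lambda>v. P v \<and> Q v)"
proof -
  from assms obtain F G
    where "finite F" "\<forall>f\<in>F. polynomial_fun V f" "\<forall>v. P v \<longleftrightarrow> (\<forall>f\<in>F. f v \<ge> 0)"
      and "finite G" "\<forall>g\<in>G. polynomial_fun V g" "\<forall>v. Q v \<longleftrightarrow> (\<forall>g\<in>G. g v \<ge> 0)"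
    unfolding polynomial_condition_def by auto
  then show ?thesis
    unfolding polynomial_condition_def by (intro exI[of _ "F \<union> G"]) auto
qed

lemma polynomial_condition_ball:
  assumes "finite I" "\<And>i. i \<in> I \<Longrightarrow> polynomial_condition V (P i)"
  shows "polynomial_condition V (\<lambda>v. \<forall>i\<in>I. P i v)"
  using assms
proof (induction I)
  case empty
  then show ?case unfolding polynomial_condition_def by (intro exI[of _ "{}"]) simp
next
  case (insert i I)
  then show ?case using polynomial_condition_conj[of V "P i" "\<lambda>v. \<forall>i\<in>I. P i v"] by simp
qed

lemma basic_semialgebraic_polynomial_condition:
  assumes "polynomial_condition V P"
  shows "basic_semialgebraic V {v \<in> nonneg_orthant V. P v}"
proof -
  from assms obtain F
    where constraints: "finite F" "\<forall>f\<in>F. polynomial_fun V f" "\<forall>v. P v \<longleftrightarrow> (\<forall>f\<in>F. f v \<ge> 0)"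
    unfolding polynomial_condition_def by blast
  from constraints(2) obtain p
    where "\<forall>f\<in>F. (\<forall>m\<in>Poly_Mapping.keys (p f). Poly_Mapping.keys m \<subseteq> V) \<and> f = eval_poly (p f)"
    unfolding polynomial_fun_def by metis
  then show ?thesis
    unfolding basic_semialgebraic_def
    by (intro exI[of _ "p ` F"]) (use constraints(1,3) in auto)
qed

text \<open>Recursing over all pivots at once turns Gaussian elimination into a conjunction of polynomial
  inequalities, with no case distinction on which pivots vanish.\<close>

lemma polynomial_condition_psd_on:
  assumes "finite I"
    and "\<And>i j. i \<in> I \<Longrightarrow> j \<in> I \<Longrightarrow> polynomial_fun V (\<lambda>v. M v i j)"
    and "\<And>v. symmetric_on I (M v)"
  shows "polynomial_condition V (\<lambda>v. psd_on I (M v))"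
  using assms
proof (induction "card I" arbitrary: I M)
  case 0
  then show ?case
    using polynomial_condition_ball[of "{}"] by (simp add: psd_on_def quadratic_form_def)
next
  case (Suc n)
  have "polynomial_condition V (\<lambda>v. psd_on (I - {i}) (schur_complement (M v) i))" if "i \<in> I" for i
  proof (rule Suc.hyps(1))
    show "n = card (I - {i})" using Suc.hyps(2) Suc.prems(1) that by simp
    show "polynomial_fun V (\<lambda>v. schur_complement (M v) i j k)" if "j \<in> I - {i}" "k \<in> I - {i}" for j k
      unfolding schur_complement_def using that \<open>i \<in> I\<close>
      by (intro polynomial_fun_diff polynomial_fun_mult Suc.prems(2)) auto
    show "symmetric_on (I - {i}) (schur_complement (M v) i)" for v
      using Suc.prems(3)[of v] by (simp add: symmetric_on_def schur_complement_def)
  qed (use Suc.prems in auto)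
  then show ?case
    unfolding psd_on_iff_all_pivots[OF Suc.prems(1,3)]
    by (intro polynomial_condition_ball polynomial_condition_conj polynomial_condition_nonneg Suc.prems)
qed


section \<open>Components and products of partially labeled graphs\<close>

lemma pl_iso_refl: "pl_edges E \<Longrightarrow> pl_iso E E"
  using pl_iso_via_id by (auto simp: pl_iso_def)

lemma abs_rep_plgraph: "abs_plgraph (rep_plgraph A) = A"
  by (rule Quotient3_abs_rep[OF Quotient3_plgraph])

lemma pl_edges_rep: "pl_edges (rep_plgraph A)"
  using Quotient3_rep_reflp[OF Quotient3_plgraph, of A] by (simp add: pl_iso_def)

lemma pl_edges_empty: "pl_edges {}"
  by (simp add: pl_edges_def)

lemma pl_edges_subset: "pl_edges E \<Longrightarrow> F \<subseteq> E \<Longrightarrow> pl_edges F"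
  unfolding pl_edges_def by (meson Union_mono finite_subset subsetD)

lemma pl_edges_Un: "pl_edges E \<Longrightarrow> pl_edges F \<Longrightarrow> pl_edges (E \<union> F)"
  by (auto simp: pl_edges_def)

lemma finite_Union_pl_edges: "pl_edges E \<Longrightarrow> finite (\<Union>E)"
  unfolding pl_edges_def by (metis card.infinite finite_Union zero_neq_numeral)

lemma pl_edges_nonempty: "pl_edges E \<Longrightarrow> e \<in> E \<Longrightarrow> e \<noteq> {}"
  unfolding pl_edges_def by force

lemma pl_edges_doubleton: "pl_edges E \<Longrightarrow> e \<in> E \<Longrightarrow> u \<in> e \<Longrightarrow> \<exists>w. e = {u, w}"
  unfolding pl_edges_def by (metis card_2_iff doubleton_eq_iff insertE singletonD)

lemma card_Union_pl_edges: "pl_edges E \<Longrightarrow> card (\<Union>E) \<le> 2 * card E"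
  using card_Union_le_sum_card[of E] by (simp add: pl_edges_def)

abbreviation image_edges :: "('a \<Rightarrow> 'b) \<Rightarrow> 'a set set \<Rightarrow> 'b set set" where
  "image_edges f E \<equiv> (\<lambda>e. f ` e) ` E"

lemma Union_image_edges: "\<Union>(image_edges f E) = f ` \<Union>E"
  by auto

lemma abs_plgraph_image_edges:
  assumes "pl_edges E" "inj_on f (\<Union>E)" "\<And>v i. v \<in> \<Union>E \<Longrightarrow> f v = Lab i \<longleftrightarrow> v = Lab i"
  shows "pl_edges (image_edges f E)" and "abs_plgraph (image_edges f E) = abs_plgraph E"
proof -
  have iso: "pl_iso_via f E (image_edges f E)"
    using assms(2,3) by (simp add: pl_iso_via_def del: Union_iff)
  have "card (f ` e) = 2" if "e \<in> E" for e
    using card_image[OF inj_on_subset[OF assms(2)], of e] that assms(1) by (auto simp: pl_edges_def)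
  moreover have "Lab 0 \<notin> f ` \<Union>E"
    using assms(1,3) unfolding pl_edges_def by (metis imageE)
  ultimately show "pl_edges (image_edges f E)"
    using assms(1) by (simp add: pl_edges_def Union_image_edges del: Union_iff)
  with assms(1) iso have "pl_iso E (image_edges f E)" by (auto simp: pl_iso_def)
  then show "abs_plgraph (image_edges f E) = abs_plgraph E"
    by (rule Quotient3_rel_abs[OF Quotient3_plgraph, symmetric])
qed

subsection \<open>Reachability and components\<close>

lemma reach_refl: "(u, u) \<in> reach E"
  by (simp add: reach_def)

lemma reach_sym: "(u, v) \<in> reach E \<Longrightarrow> (v, u) \<in> reach E"
proof -
  have "sym {(u, v). {u, v} \<in> E}" by (auto simp: sym_def insert_commute)
  then show "(u, v) \<in> reach E \<Longrightarrow> (v, u) \<in> reach E"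
    unfolding reach_def by (meson sym_rtrancl symD)
qed

lemma reach_trans: "(u, v) \<in> reach E \<Longrightarrow> (v, w) \<in> reach E \<Longrightarrow> (u, w) \<in> reach E"
  unfolding reach_def by (rule rtrancl_trans)

lemma reach_edge: "{u, v} \<in> E \<Longrightarrow> (u, v) \<in> reach E"
  by (auto simp: reach_def)

lemma reach_same_edge: "pl_edges E \<Longrightarrow> e \<in> E \<Longrightarrow> u \<in> e \<Longrightarrow> v \<in> e \<Longrightarrow> (u, v) \<in> reach E"
  using pl_edges_doubleton[of E e u] reach_edge[of u v E] reach_refl[of u E] by auto

lemma reach_mono: "E \<subseteq> F \<Longrightarrow> (u, v) \<in> reach E \<Longrightarrow> (u, v) \<in> reach F"
  unfolding reach_def using rtrancl_mono[of "{(u, v). {u, v} \<in> E}" "{(u, v). {u, v} \<in> F}"] by blast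

lemma reach_in_closed_set:
  assumes "(u, v) \<in> reach E" "u \<in> X"
    and "\<And>x y. x \<in> X \<Longrightarrow> {x, y} \<in> E \<Longrightarrow> y \<in> X \<and> {x, y} \<in> F"
  shows "(u, v) \<in> reach F \<and> v \<in> X"
  using assms(1) unfolding reach_def
proof (induction rule: rtrancl_induct)
  case base
  then show ?case using assms(2) by simp
next
  case (step y z)
  then have "z \<in> X" "{y, z} \<in> F" using assms(3) by auto
  then show ?case using step.IH by (auto intro: rtrancl_into_rtrancl)
qed

lemma reach_Union: "(u, v) \<in> reach E \<Longrightarrow> u \<in> \<Union>E \<Longrightarrow> v \<in> \<Union>E"
  using reach_in_closed_set[of u v E "\<Union>E" E] by blast

lemma reach_Un_disjoint:
  assumes "\<Union>E \<inter> \<Union>F = {}" "u \<in> \<Union>E"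
  shows "(u, v) \<in> reach (E \<union> F) \<longleftrightarrow> (u, v) \<in> reach E"
proof
  assume "(u, v) \<in> reach (E \<union> F)"
  moreover have "y \<in> \<Union>E \<and> {x, y} \<in> E" if "x \<in> \<Union>E" "{x, y} \<in> E \<union> F" for x y
  proof -
    have "{x, y} \<notin> F" using that(1) assms(1) by blast
    then show ?thesis using that(2) by blast
  qed
  ultimately show "(u, v) \<in> reach E"
    using reach_in_closed_set[of u v "E \<union> F" "\<Union>E" E] assms(2) by blast
qed (rule reach_mono[of E], simp_all)

abbreviation comps :: "vertex set set \<Rightarrow> vertex set set set" where
  "comps E \<equiv> component_edges E ` \<Union>E"

lemma Union_component_edges:
  assumes "pl_edges E" "u \<in> \<Union>E"
  shows "\<Union>(component_edges E u) = {v. (u, v) \<in> reach E}"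
proof (intro equalityI subsetI)
  fix v assume "v \<in> {v. (u, v) \<in> reach E}"
  then have reachable: "(u, v) \<in> reach E" by simp
  then obtain e where edge: "e \<in> E" "v \<in> e" using reach_Union[OF reachable assms(2)] by blast
  then have "e \<in> component_edges E u"
    using reach_same_edge[OF assms(1) edge] reach_trans[OF reachable] by (simp add: component_edges_def)
  then show "v \<in> \<Union>(component_edges E u)" using edge(2) by blast
qed (auto simp: component_edges_def)

lemma component_edges_eq:
  assumes "(u, v) \<in> reach E"
  shows "component_edges E v = component_edges E u"
proof -
  have "(u, w) \<in> reach E \<longleftrightarrow> (v, w) \<in> reach E" for w
    using assms reach_sym reach_trans by blast
  then show ?thesis by (simp add: component_edges_def)
qed

lemma comps_subset: "c \<in> comps E \<Longrightarrow> c \<subseteq> E"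
  by (auto simp: component_edges_def)

lemma comps_nonempty:
  assumes "pl_edges E" "c \<in> comps E"
  shows "c \<noteq> {}"
  using assms Union_component_edges[OF assms(1)] reach_refl by blast

lemma finite_comps: "pl_edges E \<Longrightarrow> finite (comps E)"
  using finite_Union_pl_edges by blast

lemma Union_comps:
  assumes "pl_edges E"
  shows "\<Union>(comps E) = E"
proof
  show "\<Union>(comps E) \<subseteq> E" using comps_subset by blast
  show "E \<subseteq> \<Union>(comps E)"
  proof
    fix e assume edge: "e \<in> E"
    then obtain u where endpoint: "u \<in> e" using pl_edges_nonempty[OF assms] by blast
    then have "e \<in> component_edges E u"
      using reach_same_edge[OF assms edge] edge by (simp add: component_edges_def)
    then show "e \<in> \<Union>(comps E)" using edge endpoint by blast
  qed
qed

lemma comps_eq_or_disjoint: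
  assumes "c \<in> comps E" "c' \<in> comps E" "c \<noteq> c'"
  shows "\<Union>c \<inter> \<Union>c' = {}"
proof (rule ccontr)
  assume "\<Union>c \<inter> \<Union>c' \<noteq> {}"
  then obtain w where common_vertex: "w \<in> \<Union>c" "w \<in> \<Union>c'" by blast
  obtain u u' where "c = component_edges E u" "c' = component_edges E u'" using assms by blast
  then have "component_edges E w = c" "component_edges E w = c'"
    using common_vertex component_edges_eq[of _ w E] by (auto simp: component_edges_def)
  then show False using assms(3) by simp
qed

lemma component_connected:
  assumes "pl_edges E" "c \<in> comps E" "u \<in> \<Union>c" "v \<in> \<Union>c"
  shows "(u, v) \<in> reach c"
proof -
  obtain r where representative: "c = component_edges E r" "r \<in> \<Union>E" using assms(2) by blast
  have root: "(r, w) \<in> reach E \<longleftrightarrow> w \<in> \<Union>c" for w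
    using Union_component_edges[OF assms(1) representative(2)] representative(1) by simp
  have "y \<in> \<Union>c \<and> {x, y} \<in> c" if "x \<in> \<Union>c" "{x, y} \<in> E" for x y
  proof -
    have "(r, x) \<in> reach E" "(r, y) \<in> reach E"
      using that root reach_trans[OF _ reach_edge] by blast+
    then have "{x, y} \<in> c" using that(2) by (simp add: representative(1) component_edges_def)
    then show ?thesis by blast
  qed
  moreover have "(u, v) \<in> reach E" using assms(3,4) root reach_sym reach_trans by blast
  ultimately show ?thesis using reach_in_closed_set[of u v E "\<Union>c" c] assms(3) by blast
qed

lemma component_edges_Un_disjoint:
  assumes "pl_edges F" "\<Union>E \<inter> \<Union>F = {}" "u \<in> \<Union>E"
  shows "component_edges (E \<union> F) u = component_edges E u"
proof -
  have "e \<notin> F" if "\<forall>w\<in>e. (u, w) \<in> reach E" for e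
  proof
    assume edge: "e \<in> F"
    then obtain w where "w \<in> e" using pl_edges_nonempty[OF assms(1)] by blast
    then have "w \<in> \<Union>E" "w \<in> \<Union>F" using that reach_Union[OF _ assms(3)] edge by blast+
    then show False using assms(2) by blast
  qed
  then show ?thesis
    unfolding component_edges_def reach_Un_disjoint[OF assms(2,3)] by blast
qed

lemma comps_Un_disjoint:
  assumes "pl_edges E" "pl_edges F" "\<Union>E \<inter> \<Union>F = {}"
  shows "comps (E \<union> F) = comps E \<union> comps F"
proof -
  have "component_edges (E \<union> F) ` \<Union>E = comps E"
    using component_edges_Un_disjoint[OF assms(2,3)] by (intro image_cong) auto
  moreover have "component_edges (E \<union> F) ` \<Union>F = comps F"
    using component_edges_Un_disjoint[of E F] assms(1,3)
    by (intro image_cong) (auto simp: Un_commute Int_commute)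
  ultimately show ?thesis by (simp add: Union_Un_distrib image_Un)
qed

lemma graph_components_abs:
  "pl_edges E \<Longrightarrow> graph_components (abs_plgraph E) = image_mset abs_plgraph (mset_set (comps E))"
  by (rule graph_components.abs_eq) (rule pl_iso_refl)

lemma set_graph_components_abs:
  "pl_edges E \<Longrightarrow> set_mset (graph_components (abs_plgraph E)) = abs_plgraph ` comps E"
  using finite_comps by (simp add: graph_components_abs)

lemma graph_components_Un_disjoint:
  assumes "pl_edges E" "pl_edges F" "\<Union>E \<inter> \<Union>F = {}"
  shows "graph_components (abs_plgraph (E \<union> F)) =
    graph_components (abs_plgraph E) + graph_components (abs_plgraph F)"
proof -
  have "comps E \<inter> comps F = {}"
  proof (rule equals0I)
    fix c assume "c \<in> comps E \<inter> comps F"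
    then have "c \<in> comps E" "c \<in> comps F" by (rule IntD1, rule IntD2)
    then have "c \<subseteq> E" "c \<subseteq> F" "c \<noteq> {}" using comps_subset comps_nonempty[OF assms(1)] by metis+
    then obtain e where "e \<in> E" "e \<in> F" "e \<noteq> {}" using pl_edges_nonempty[OF assms(1)] by blast
    then show False using assms(3) by blast
  qed
  then show ?thesis
    using assms by (simp only: graph_components_abs pl_edges_Un comps_Un_disjoint
        mset_set_Union finite_comps image_mset_union)
qed

subsection \<open>The bases and the moment matrix\<close>

lemma num_edges_abs: "pl_edges E \<Longrightarrow> num_edges (abs_plgraph E) = card E"
  by (intro num_edges.abs_eq pl_iso_refl)

lemma labels_abs: "pl_edges E \<Longrightarrow> labels (abs_plgraph E) = {i. Lab i \<in> \<Union>E}"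
  by (intro labels.abs_eq pl_iso_refl)

lemma glue_abs:
  "pl_edges E \<Longrightarrow> pl_edges F \<Longrightarrow> glue (abs_plgraph E) (abs_plgraph F) = abs_plgraph (glue_edges E F)"
  by (intro glue.abs_eq pl_iso_refl)

lemma unlabel_abs: "pl_edges E \<Longrightarrow> unlabel (abs_plgraph E) = abs_plgraph (image_edges unl E)"
  by (intro unlabel.abs_eq pl_iso_refl)

lemma moment_matrix_abs:
  "pl_edges E \<Longrightarrow> pl_edges F \<Longrightarrow> moment_matrix (abs_plgraph E) (abs_plgraph F) =
     graph_components (abs_plgraph (image_edges unl (glue_edges E F)))"
  by (simp add: moment_matrix_def glue_abs unlabel_abs pl_edges_glue)

lemma basis_iff: "A \<in> basis d l \<longleftrightarrow> num_edges A \<le> d \<and> labels A \<subseteq> {1..l}"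
  using num_edges_abs[OF pl_edges_empty] labels_abs[OF pl_edges_empty]
  by (auto simp: basis_def empty_graph_def)

abbreviation label_vertices :: "nat \<Rightarrow> vertex set" where
  "label_vertices l \<equiv> Lab ` {1..l}"

lemma basis_abs:
  "pl_edges E \<Longrightarrow> abs_plgraph E \<in> basis d l \<longleftrightarrow> card E \<le> d \<and> \<Union>E \<inter> range Lab \<subseteq> label_vertices l"
  by (auto simp: basis_iff num_edges_abs labels_abs)

lemma basis_rep:
  "A \<in> basis d l \<longleftrightarrow> card (rep_plgraph A) \<le> d \<and> \<Union>(rep_plgraph A) \<inter> range Lab \<subseteq> label_vertices l"
  using basis_abs[OF pl_edges_rep[of A]] by (simp add: abs_rep_plgraph)

lemma basis_subset_edges:
  assumes "pl_edges E" "F \<subseteq> E" "abs_plgraph E \<in> basis d l"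
  shows "abs_plgraph F \<in> basis d l"
proof -
  have "card F \<le> card E" using assms(1,2) by (intro card_mono) (auto simp: pl_edges_def)
  moreover have "\<Union>F \<subseteq> \<Union>E" using assms(2) by blast
  ultimately show ?thesis
    using assms(3) unfolding basis_abs[OF assms(1)] basis_abs[OF pl_edges_subset[OF assms(1,2)]]
    by (meson Int_mono order_refl order_trans)
qed

lemma canonical_representative:
  assumes "pl_edges E"
  obtains F where "pl_edges F" "abs_plgraph F = abs_plgraph E"
    and "\<Union>F \<subseteq> \<Union>E \<inter> range Lab \<union> Unl ` {..<2 * card E}"
proof -
  let ?U = "\<Union>E - range Lab"
  have finite_vertices: "finite (\<Union>E)" by (rule finite_Union_pl_edges[OF assms])
  have "card ?U \<le> 2 * card E"
    using card_mono[OF finite_vertices, of ?U] card_Union_pl_edges[OF assms] by auto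
  then obtain g where numbering: "inj_on g ?U" "g ` ?U \<subseteq> {..<2 * card E}"
    using inj_on_iff_card_le[of ?U "{..<2 * card E}"] finite_vertices by auto
  define f where "f v = (if v \<in> range Lab then v else Unl (g v))" for v
  have "inj_on f (\<Union>E)"
    using numbering(1) unfolding inj_on_def f_def by (auto simp del: Union_iff)
  moreover have "f v = Lab i \<longleftrightarrow> v = Lab i" for v i by (auto simp: f_def)
  ultimately have "pl_edges (image_edges f E)" "abs_plgraph (image_edges f E) = abs_plgraph E"
    using abs_plgraph_image_edges[OF assms] by blast+
  moreover have "\<Union>(image_edges f E) \<subseteq> \<Union>E \<inter> range Lab \<union> Unl ` {..<2 * card E}"
    unfolding Union_image_edges using numbering(2) by (auto simp: f_def simp del: Union_iff)
  ultimately show thesis by (rule that)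
qed

lemma finite_basis: "finite (basis d l)"
proof -
  let ?X = "label_vertices l \<union> Unl ` {..<2 * d}"
  have "basis d l \<subseteq> abs_plgraph ` Pow (Pow ?X)"
  proof
    fix A assume "A \<in> basis d l"
    then have size_and_labels: "card (rep_plgraph A) \<le> d"
        "\<Union>(rep_plgraph A) \<inter> range Lab \<subseteq> label_vertices l"
      by (simp_all add: basis_rep)
    obtain F where canonical: "abs_plgraph F = abs_plgraph (rep_plgraph A)"
        "\<Union>F \<subseteq> \<Union>(rep_plgraph A) \<inter> range Lab \<union> Unl ` {..<2 * card (rep_plgraph A)}"
      by (rule canonical_representative[OF pl_edges_rep])
    have "Unl ` {..<2 * card (rep_plgraph A)} \<subseteq> Unl ` {..<2 * d}" using size_and_labels(1) by auto
    then have "\<Union>F \<subseteq> ?X" using canonical(2) size_and_labels(2) by (meson Un_mono order_trans)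
    then have "F \<in> Pow (Pow ?X)" by (metis PowI Union_upper order_trans subsetI)
    then show "A \<in> abs_plgraph ` Pow (Pow ?X)" using canonical(1) by (metis abs_rep_plgraph image_eqI)
  qed
  then show ?thesis by (rule finite_subset) simp
qed

lemma finite_variables: "finite (variables d l)"
proof -
  have "variables d l \<subseteq> (\<lambda>(A, B). unlabel (glue A B)) ` (basis d l \<times> basis d l)"
    unfolding variables_def by auto
  then show ?thesis by (rule finite_subset) (simp add: finite_basis)
qed

lemma subset_unlabel_glue_edges:
  assumes "c \<subseteq> image_edges unl (glue_edges E F)"
  obtains E' F' where "E' \<subseteq> E" "F' \<subseteq> F" "c = image_edges unl (glue_edges E' F')"
proof
  show "c = image_edges unl (glue_edges {e \<in> E. unl ` tag0 ` e \<in> c} {e \<in> F. unl ` tag1 ` e \<in> c})"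
    using assms unfolding glue_edges_def by auto
qed auto

lemma moment_matrix_variables:
  assumes "A \<in> basis d l" "B \<in> basis d l"
  shows "set_mset (moment_matrix A B) \<subseteq> variables d l"
proof -
  let ?E = "rep_plgraph A" and ?F = "rep_plgraph B"
  let ?G = "image_edges unl (glue_edges ?E ?F)"
  have pl_edges_G: "pl_edges ?G" by (intro pl_edges_unl pl_edges_glue pl_edges_rep)
  have "abs_plgraph c \<in> variables d l" if component: "c \<in> comps ?G" for c
  proof -
    have pl_edges_c: "pl_edges c" using pl_edges_subset[OF pl_edges_G comps_subset[OF component]] .
    obtain E' F' where subgraphs: "E' \<subseteq> ?E" "F' \<subseteq> ?F" and c_eq: "c = image_edges unl (glue_edges E' F')"
      by (rule subset_unlabel_glue_edges[OF comps_subset[OF component]])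
    have parts: "abs_plgraph E' \<in> basis d l" "abs_plgraph F' \<in> basis d l"
      using basis_subset_edges[OF pl_edges_rep] subgraphs assms by (simp_all add: abs_rep_plgraph)
    have "abs_plgraph c = unlabel (glue (abs_plgraph E') (abs_plgraph F'))"
      using pl_edges_subset[OF pl_edges_rep] subgraphs
      by (simp add: c_eq glue_abs unlabel_abs pl_edges_glue)
    moreover have "connected_graph (abs_plgraph c)"
      unfolding connected_graph.abs_eq[OF pl_iso_refl[OF pl_edges_c]]
      using component_connected[OF pl_edges_G component] by blast
    moreover have "abs_plgraph c \<noteq> empty_graph"
      using num_edges_abs[OF pl_edges_c] num_edges_abs[OF pl_edges_empty] pl_edges_c
        comps_nonempty[OF pl_edges_G component]
      by (auto simp: empty_graph_def pl_edges_def)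
    ultimately show ?thesis using parts unfolding variables_def by auto
  qed
  then show ?thesis
    using moment_matrix_abs[OF pl_edges_rep pl_edges_rep, of A B] set_graph_components_abs[OF pl_edges_G]
    by (auto simp: abs_rep_plgraph)
qed

lemma moment_matrix_commute: "moment_matrix A B = moment_matrix B A"
proof -
  let ?E = "rep_plgraph A" and ?F = "rep_plgraph B"
  define h where
    "h v = (case v of Lab i \<Rightarrow> Lab i | Unl j \<Rightarrow> if even j then Unl (j + 1) else Unl (j - 1))" for v
  have h_tag: "h (tag0 v) = tag1 v" "h (tag1 v) = tag0 v" for v
    by (cases v; simp add: h_def)+
  have "inj h"
    by (rule injI) (auto simp: h_def split: vertex.splits if_splits, presburger+)
  moreover have "h v = Lab i \<longleftrightarrow> v = Lab i" for v i by (auto simp: h_def split: vertex.splits)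
  ultimately have "abs_plgraph (image_edges h (glue_edges ?E ?F)) = abs_plgraph (glue_edges ?E ?F)"
    using pl_edges_glue[OF pl_edges_rep pl_edges_rep]
    by (intro abs_plgraph_image_edges(2)) (auto intro: inj_on_subset)
  moreover have "image_edges h (glue_edges ?E ?F) = glue_edges ?F ?E"
    by (simp add: glue_edges_def image_Un image_image h_tag Un_commute)
  ultimately have "glue (abs_plgraph ?E) (abs_plgraph ?F) = glue (abs_plgraph ?F) (abs_plgraph ?E)"
    by (simp add: glue_abs pl_edges_rep)
  then show ?thesis by (simp add: abs_rep_plgraph moment_matrix_def)
qed

lemma unlabel_glue_edges_disjoint:
  assumes "\<Union>E1 \<inter> \<Union>E2 = {}" "\<Union>E2 \<inter> range Lab = {}"
  shows "\<Union>(image_edges unl (glue_edges E1 F)) \<inter> \<Union>(image_edges (unl \<circ> tag0) E2) = {}"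
proof (rule equals0I)
  have glued_vertices: "\<Union>(image_edges unl (glue_edges E1 F)) = unl ` (tag0 ` \<Union>E1 \<union> tag1 ` \<Union>F)"
    by (simp only: glue_edges_def Union_image_edges Union_Un_distrib)
  fix z assume "z \<in> \<Union>(image_edges unl (glue_edges E1 F)) \<inter> \<Union>(image_edges (unl \<circ> tag0) E2)"
  then have common_vertex: "z \<in> unl ` (tag0 ` \<Union>E1 \<union> tag1 ` \<Union>F)" "z \<in> (unl \<circ> tag0) ` \<Union>E2"
    unfolding glued_vertices Union_image_edges[of "unl \<circ> tag0"] by (rule IntD1, rule IntD2)
  obtain w where preimage: "z = (unl \<circ> tag0) w" "w \<in> \<Union>E2" using common_vertex(2) by (rule imageE)
  have "tag0 w \<in> tag0 ` \<Union>E1 \<or> tag0 w \<in> tag1 ` \<Union>F"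
    using common_vertex(1) unfolding preimage(1) comp_apply inj_image_mem_iff[OF unl_inj] Un_iff .
  then show False
  proof
    assume "tag0 w \<in> tag0 ` \<Union>E1"
    then have "w \<in> \<Union>E1" unfolding inj_image_mem_iff[OF tag0_inj] .
    then show False using preimage(2) assms(1) by blast
  next
    assume "tag0 w \<in> tag1 ` \<Union>F"
    then obtain u where "tag0 w = tag1 u" by (rule imageE)
    then have "w \<in> range Lab" by (auto simp: tag0_eq_tag1)
    then show False using preimage(2) assms(2) by blast
  qed
qed

lemma moment_matrix_split_unlabeled:
  assumes pl_edges_E: "pl_edges (E1 \<union> E2)" and pl_edges_F: "pl_edges F"
    and disjoint: "\<Union>E1 \<inter> \<Union>E2 = {}" and no_label: "\<Union>E2 \<inter> range Lab = {}"
  shows "moment_matrix (abs_plgraph (E1 \<union> E2)) (abs_plgraph F) =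
    moment_matrix (abs_plgraph E1) (abs_plgraph F) + graph_components (abs_plgraph E2)"
proof -
  let ?X = "image_edges unl (glue_edges E1 F)" and ?Y = "image_edges (unl \<circ> tag0) E2"
  have parts: "pl_edges E1" "pl_edges E2" using pl_edges_subset[OF pl_edges_E] by auto
  have inj: "inj (unl \<circ> tag0)" by (rule inj_compose[OF unl_inj tag0_inj])
  have unl_not_Lab: "unl v \<noteq> Lab i" for v i by (cases v) auto
  have pl_edges_X: "pl_edges ?X" by (intro pl_edges_unl pl_edges_glue parts pl_edges_F)
  have unlabeled_copy: "pl_edges ?Y" "abs_plgraph ?Y = abs_plgraph E2"
    using no_label unl_not_Lab
    by (intro abs_plgraph_image_edges[OF parts(2) inj_on_subset[OF inj]]; fastforce)+
  have "image_edges unl (glue_edges (E1 \<union> E2) F) = ?X \<union> ?Y"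
    unfolding glue_edges_def image_Un image_image comp_def by blast
  then show ?thesis
    unfolding moment_matrix_abs[OF pl_edges_E pl_edges_F] moment_matrix_abs[OF parts(1) pl_edges_F]
    using graph_components_Un_disjoint[OF pl_edges_X unlabeled_copy(1)
        unlabel_glue_edges_disjoint[OF disjoint no_label]] unlabeled_copy(2)
    by simp
qed

subsection \<open>The reduced basis\<close>

definition label_rooted :: "vertex set set \<Rightarrow> bool" where
  "label_rooted E \<longleftrightarrow> (\<forall>v\<in>\<Union>E. \<exists>i. (v, Lab i) \<in> reach E)"

lemma reduced_basis_abs:
  assumes "pl_edges E"
  shows "abs_plgraph E \<in> reduced_basis d l \<longleftrightarrow> abs_plgraph E \<in> basis d l \<and> label_rooted E"
proof -
  have "labels (abs_plgraph (component_edges E v)) = {i. (v, Lab i) \<in> reach E}" if "v \<in> \<Union>E" for v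
    using Union_component_edges[OF assms that] comps_subset[OF imageI[OF that]]
    by (subst labels_abs) (auto intro: pl_edges_subset[OF assms])
  then have "(\<forall>C\<in>#graph_components (abs_plgraph E). labels C \<noteq> {}) \<longleftrightarrow> label_rooted E"
    unfolding set_graph_components_abs[OF assms] label_rooted_def by blast
  moreover have "graph_components empty_graph = {#}" "empty_graph \<in> basis d l"
    using graph_components_abs[OF pl_edges_empty] by (simp_all add: empty_graph_def basis_def)
  ultimately show ?thesis by (auto simp: reduced_basis_def)
qed

lemma label_rooted_rep: "A \<in> reduced_basis d l \<Longrightarrow> label_rooted (rep_plgraph A)"
  using reduced_basis_abs[OF pl_edges_rep[of A]] by (simp add: abs_rep_plgraph)

lemma reduced_basis_subset: "reduced_basis d l \<subseteq> basis d l"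
  by (auto simp: reduced_basis_def basis_def)

lemma finite_reduced_basis: "finite (reduced_basis d l)"
  using finite_subset[OF reduced_basis_subset finite_basis] .

definition labeled_part :: "vertex set set \<Rightarrow> vertex set set" where
  "labeled_part E = {e \<in> E. \<exists>v\<in>e. \<exists>i. (v, Lab i) \<in> reach E}"

lemma labeled_part_subset: "labeled_part E \<subseteq> E"
  by (auto simp: labeled_part_def)

lemma mem_labeled_part_iff:
  assumes "pl_edges E" "e \<in> E" "v \<in> e"
  shows "e \<in> labeled_part E \<longleftrightarrow> (\<exists>i. (v, Lab i) \<in> reach E)"
  using assms reach_same_edge[OF assms(1,2)] reach_trans unfolding labeled_part_def by blast

lemma label_rooted_labeled_part:
  assumes "pl_edges E"
  shows "label_rooted (labeled_part E)"
  unfolding label_rooted_def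
proof
  let ?X = "{x. \<exists>i. (x, Lab i) \<in> reach E}"
  fix v assume "v \<in> \<Union>(labeled_part E)"
  then obtain i where to_label: "(v, Lab i) \<in> reach E"
    using mem_labeled_part_iff[OF assms] labeled_part_subset by blast
  have "y \<in> ?X \<and> {x, y} \<in> labeled_part E" if "x \<in> ?X" "{x, y} \<in> E" for x y
    using that mem_labeled_part_iff[OF assms that(2), of x] mem_labeled_part_iff[OF assms that(2), of y]
    by blast
  then show "\<exists>i. (v, Lab i) \<in> reach (labeled_part E)"
    using reach_in_closed_set[OF to_label, of ?X "labeled_part E"] to_label by blast
qed

lemma labeled_part_disjoint:
  "pl_edges E \<Longrightarrow> \<Union>(labeled_part E) \<inter> \<Union>(E - labeled_part E) = {}"
  using mem_labeled_part_iff labeled_part_subset by blast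

lemma unlabeled_part_no_label:
  "pl_edges E \<Longrightarrow> \<Union>(E - labeled_part E) \<inter> range Lab = {}"
  using mem_labeled_part_iff reach_refl by blast

lemma moment_matrix_reduce:
  assumes "A \<in> basis d l"
  obtains A' m where "A' \<in> reduced_basis d l" "\<And>B. moment_matrix A B = moment_matrix A' B + m"
proof
  let ?E = "rep_plgraph A"
  let ?F = "labeled_part ?E"
  have E_eq: "?F \<union> (?E - ?F) = ?E" using labeled_part_subset by blast
  show "abs_plgraph ?F \<in> reduced_basis d l"
    using reduced_basis_abs[OF pl_edges_subset[OF pl_edges_rep labeled_part_subset]]
      basis_subset_edges[OF pl_edges_rep labeled_part_subset, of A] assms
    by (simp add: abs_rep_plgraph label_rooted_labeled_part pl_edges_rep)
  show "moment_matrix A B =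
      moment_matrix (abs_plgraph ?F) B + graph_components (abs_plgraph (?E - ?F))" for B
    using moment_matrix_split_unlabeled[of ?F "?E - ?F" "rep_plgraph B", unfolded E_eq]
    by (simp add: pl_edges_rep labeled_part_disjoint unlabeled_part_no_label abs_rep_plgraph)
qed


section \<open>Densities of products as averages over the labels\<close>

text \<open>Averaging over the coordinates in \<open>X\<close> is the conditional expectation given the other coordinates.\<close>

definition avg :: "'a set \<Rightarrow> 'b set \<Rightarrow> (('a \<Rightarrow> 'b) \<Rightarrow> real) \<Rightarrow> ('a \<Rightarrow> 'b) \<Rightarrow> real" where
  "avg X W f \<phi> = (\<Sum>\<psi>\<in>X \<rightarrow>\<^sub>E W. f (override_on \<phi> \<psi> X)) / card (X \<rightarrow>\<^sub>E W)"

definition depends_on :: "(('a \<Rightarrow> 'b) \<Rightarrow> 'c) \<Rightarrow> 'a set \<Rightarrow> bool" where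
  "depends_on f V \<longleftrightarrow> (\<forall>\<phi> \<psi>. (\<forall>v\<in>V. \<phi> v = \<psi> v) \<longrightarrow> f \<phi> = f \<psi>)"

lemma depends_onD: "depends_on f V \<Longrightarrow> (\<And>v. v \<in> V \<Longrightarrow> \<phi> v = \<psi> v) \<Longrightarrow> f \<phi> = f \<psi>"
  by (simp add: depends_on_def)

lemma depends_on_override_on:
  assumes "depends_on f V" "V \<inter> X = {}"
  shows "f (override_on \<phi> \<psi> X) = f \<phi>"
  using assms(2) by (intro depends_onD[OF assms(1)]) (auto simp: override_on_def)

lemma depends_on_avg:
  assumes "depends_on f V"
  shows "depends_on (avg X W f) (V - X)"
  unfolding depends_on_def avg_def
proof (intro allI impI arg_cong2[where f = "(/)"] sum.cong refl)
  fix \<phi> \<phi>' \<psi> :: "'a \<Rightarrow> 'b"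
  assume "\<forall>v\<in>V - X. \<phi> v = \<phi>' v"
  then show "f (override_on \<phi> \<psi> X) = f (override_on \<phi>' \<psi> X)"
    by (intro depends_onD[OF assms]) (auto simp: override_on_def)
qed

lemma avg_empty: "avg {} W f = f"
  by (simp add: avg_def fun_eq_iff)

lemma avg_undefined: "avg X W f (\<lambda>_. undefined) = (\<Sum>\<psi>\<in>X \<rightarrow>\<^sub>E W. f \<psi>) / card (X \<rightarrow>\<^sub>E W)"
proof -
  have "override_on (\<lambda>_. undefined) \<psi> X = \<psi>" if "\<psi> \<in> X \<rightarrow>\<^sub>E W" for \<psi>
    using PiE_arb[OF that] by (auto simp: override_on_def)
  then show ?thesis by (simp add: avg_def)
qed

lemma avg_nonneg: "(\<And>\<psi>. f \<psi> \<ge> 0) \<Longrightarrow> avg X W f \<phi> \<ge> 0"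
  by (simp add: avg_def sum_nonneg)

lemma avg_mult_left:
  assumes "depends_on f V" "V \<inter> X = {}"
  shows "avg X W (\<lambda>\<phi>. f \<phi> * g \<phi>) \<phi> = f \<phi> * avg X W g \<phi>"
  by (simp add: avg_def depends_on_override_on[OF assms] sum_distrib_left)

lemma avg_eq_self:
  assumes "finite X" "finite W" "W \<noteq> {}" "depends_on f V" "V \<inter> X = {}"
  shows "avg X W f \<phi> = f \<phi>"
proof -
  have "card (X \<rightarrow>\<^sub>E W) > 0" using assms(1-3) by (simp add: card_PiE card_gt_0_iff)
  then show ?thesis by (simp add: avg_def depends_on_override_on[OF assms(4,5)])
qed

lemma bij_betw_PiE_Un:
  assumes "X \<inter> Y = {}"
  shows "bij_betw (\<lambda>(\<phi>, \<psi>). override_on \<phi> \<psi> Y) ((X \<rightarrow>\<^sub>E W) \<times> (Y \<rightarrow>\<^sub>E W)) (X \<union> Y \<rightarrow>\<^sub>E W)"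
proof (rule bij_betw_byWitness[where f' = "\<lambda>\<eta>. (restrict \<eta> X, restrict \<eta> Y)"])
  show "\<forall>p\<in>(X \<rightarrow>\<^sub>E W) \<times> (Y \<rightarrow>\<^sub>E W).
      (\<lambda>\<eta>. (restrict \<eta> X, restrict \<eta> Y)) ((\<lambda>(\<phi>, \<psi>). override_on \<phi> \<psi> Y) p) = p"
    using assms by (fastforce simp: fun_eq_iff override_on_def PiE_iff extensional_def)
qed (auto simp: fun_eq_iff override_on_def PiE_iff extensional_def)

lemma avg_Un:
  assumes "finite X" "finite Y" "finite W" "X \<inter> Y = {}"
  shows "avg (X \<union> Y) W f = avg X W (avg Y W f)"
proof
  fix \<phi>
  have "(\<Sum>\<psi>\<in>X \<rightarrow>\<^sub>E W. \<Sum>\<eta>\<in>Y \<rightarrow>\<^sub>E W. f (override_on (override_on \<phi> \<psi> X) \<eta> Y)) =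
      (\<Sum>p\<in>(X \<rightarrow>\<^sub>E W) \<times> (Y \<rightarrow>\<^sub>E W). f (override_on \<phi> (case p of (\<psi>, \<eta>) \<Rightarrow> override_on \<psi> \<eta> Y) (X \<union> Y)))"
  proof -
    have "override_on (override_on \<phi> \<psi> X) \<eta> Y = override_on \<phi> (override_on \<psi> \<eta> Y) (X \<union> Y)" for \<psi> \<eta>
      by (auto simp: override_on_def)
    then show ?thesis by (simp add: sum.cartesian_product split_def)
  qed
  also have "\<dots> = (\<Sum>\<zeta>\<in>X \<union> Y \<rightarrow>\<^sub>E W. f (override_on \<phi> \<zeta> (X \<union> Y)))"
    by (rule sum.reindex_bij_betw[OF bij_betw_PiE_Un[OF assms(4)]])
  finally have iterated_sum: "(\<Sum>\<psi>\<in>X \<rightarrow>\<^sub>E W. \<Sum>\<eta>\<in>Y \<rightarrow>\<^sub>E W. f (override_on (override_on \<phi> \<psi> X) \<eta> Y)) =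
      (\<Sum>\<zeta>\<in>X \<union> Y \<rightarrow>\<^sub>E W. f (override_on \<phi> \<zeta> (X \<union> Y)))" .
  have "card (X \<union> Y \<rightarrow>\<^sub>E W) = card (X \<rightarrow>\<^sub>E W) * card (Y \<rightarrow>\<^sub>E W)"
    using bij_betw_same_card[OF bij_betw_PiE_Un[OF assms(4), of W]] by (simp add: card_cartesian_product)
  then show "avg (X \<union> Y) W f \<phi> = avg X W (avg Y W f) \<phi>"
    unfolding avg_def sum_divide_distrib[symmetric] iterated_sum by simp
qed

lemma avg_mult:
  assumes "finite X" "finite Y" "finite W" "X \<inter> Y = {}"
    and "depends_on f V" "V \<inter> Y = {}" "depends_on g U" "U \<inter> X = {}"
  shows "avg (X \<union> Y) W (\<lambda>\<phi>. f \<phi> * g \<phi>) \<phi> = avg X W f \<phi> * avg Y W g \<phi>"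
proof -
  have "avg (X \<union> Y) W (\<lambda>\<phi>. f \<phi> * g \<phi>) \<phi> = avg X W (\<lambda>\<phi>. avg Y W g \<phi> * f \<phi>) \<phi>"
    unfolding avg_Un[OF assms(1-4)] avg_mult_left[OF assms(5,6)] by (simp add: mult.commute)
  also have "\<dots> = avg Y W g \<phi> * avg X W f \<phi>"
    using assms(8) by (intro avg_mult_left[OF depends_on_avg[OF assms(7)]]) blast
  finally show ?thesis by simp
qed

lemma bij_betw_PiE_image:
  assumes "inj_on h X"
  shows "bij_betw (\<lambda>\<psi>. restrict (\<psi> \<circ> h) X) (h ` X \<rightarrow>\<^sub>E W) (X \<rightarrow>\<^sub>E W)"
  by (rule bij_betw_byWitness[where f' = "\<lambda>\<psi>. restrict (\<psi> \<circ> inv_into X h) (h ` X)"])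
    (use assms in \<open>auto simp: fun_eq_iff PiE_iff extensional_def inv_into_f_f\<close>)

lemma avg_comp:
  assumes "inj h"
  shows "avg (h ` X) W (\<lambda>\<phi>. f (\<phi> \<circ> h)) \<phi> = avg X W f (\<phi> \<circ> h)"
proof -
  have bij: "bij_betw (\<lambda>\<psi>. restrict (\<psi> \<circ> h) X) (h ` X \<rightarrow>\<^sub>E W) (X \<rightarrow>\<^sub>E W)"
    using assms by (intro bij_betw_PiE_image) (auto intro: inj_on_subset)
  have "override_on \<phi> \<psi> (h ` X) \<circ> h = override_on (\<phi> \<circ> h) (restrict (\<psi> \<circ> h) X) X" for \<psi>
    using assms by (auto simp: override_on_def fun_eq_iff inj_image_mem_iff)
  then have "(\<Sum>\<psi>\<in>h ` X \<rightarrow>\<^sub>E W. f (override_on \<phi> \<psi> (h ` X) \<circ> h)) =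
      (\<Sum>\<psi>\<in>X \<rightarrow>\<^sub>E W. f (override_on (\<phi> \<circ> h) \<psi> X))"
    using sum.reindex_bij_betw[OF bij, of "\<lambda>\<psi>. f (override_on (\<phi> \<circ> h) \<psi> X)"] by simp
  then show ?thesis
    by (simp add: avg_def bij_betw_same_card[OF bij])
qed

definition hom_indicator :: "'a set set \<Rightarrow> 'b set set \<Rightarrow> ('a \<Rightarrow> 'b) \<Rightarrow> real" where
  "hom_indicator E D \<phi> = of_bool (\<forall>e\<in>E. \<phi> ` e \<in> D)"

lemma hom_indicator_empty: "hom_indicator {} D \<phi> = 1"
  by (simp add: hom_indicator_def)

lemma hom_indicator_Un: "hom_indicator (E \<union> F) D \<phi> = hom_indicator E D \<phi> * hom_indicator F D \<phi>"
  by (auto simp: hom_indicator_def)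

lemma hom_indicator_image_edges: "hom_indicator (image_edges h E) D \<phi> = hom_indicator E D (\<phi> \<circ> h)"
  by (simp add: hom_indicator_def image_comp)

lemma depends_on_hom_indicator: "depends_on (hom_indicator E D) (\<Union>E)"
  unfolding depends_on_def hom_indicator_def
proof (intro allI impI)
  fix \<phi> \<psi> :: "'a \<Rightarrow> 'b"
  assume "\<forall>v\<in>\<Union>E. \<phi> v = \<psi> v"
  then have "\<phi> ` e = \<psi> ` e" if "e \<in> E" for e using that by (intro image_cong) auto
  then show "(of_bool (\<forall>e\<in>E. \<phi> ` e \<in> D) :: real) = of_bool (\<forall>e\<in>E. \<psi> ` e \<in> D)" by simp
qed

definition rooted_density :: "'a set \<Rightarrow> 'a set set \<Rightarrow> 'b set \<Rightarrow> 'b set set \<Rightarrow> ('a \<Rightarrow> 'b) \<Rightarrow> real" where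
  "rooted_density R E W D = avg (\<Union>E - R) W (hom_indicator E D)"

lemma depends_on_rooted_density: "depends_on (rooted_density R E W D) (\<Union>E \<inter> R)"
  using depends_on_avg[OF depends_on_hom_indicator, of "\<Union>E - R" W E D]
  by (simp add: rooted_density_def Diff_Diff_Int)

lemma rooted_density_nonneg: "rooted_density R E W D \<phi> \<ge> 0"
  unfolding rooted_density_def by (rule avg_nonneg) (simp add: hom_indicator_def)

lemma rooted_density_Un:
  assumes "finite (\<Union>E)" "finite (\<Union>F)" "finite W" "\<Union>E \<inter> \<Union>F \<subseteq> R"
  shows "rooted_density R (E \<union> F) W D \<phi> = rooted_density R E W D \<phi> * rooted_density R F W D \<phi>"
  unfolding rooted_density_def hom_indicator_Un Union_Un_distrib Un_Diff
  using assms by (intro avg_mult[OF _ _ _ _ depends_on_hom_indicator _ depends_on_hom_indicator]) auto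

lemma rooted_density_Union:
  assumes "finite \<C>" "finite W" "\<And>c. c \<in> \<C> \<Longrightarrow> finite (\<Union>c)"
    and "\<And>c c'. c \<in> \<C> \<Longrightarrow> c' \<in> \<C> \<Longrightarrow> c \<noteq> c' \<Longrightarrow> \<Union>c \<inter> \<Union>c' \<subseteq> R"
  shows "rooted_density R (\<Union>\<C>) W D \<phi> = (\<Prod>c\<in>\<C>. rooted_density R c W D \<phi>)"
  using assms
proof (induction \<C>)
  case empty
  then show ?case by (simp add: rooted_density_def avg_empty hom_indicator_empty)
next
  case (insert c \<C>)
  have "\<Union>c \<inter> \<Union>c' \<subseteq> R" if "c' \<in> \<C>" for c'
    using insert.prems(3)[of c c'] insert.hyps(2) that by (metis insertCI)
  then have "\<Union>c \<inter> \<Union>(\<Union>\<C>) \<subseteq> R" by blast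
  moreover have "finite (\<Union>(\<Union>\<C>))"
  proof -
    have "\<Union>(\<Union>\<C>) = (\<Union>c\<in>\<C>. \<Union>c)" by blast
    then show ?thesis using insert.hyps(1) insert.prems(2) by simp
  qed
  ultimately have "rooted_density R (c \<union> \<Union>\<C>) W D \<phi> =
      rooted_density R c W D \<phi> * rooted_density R (\<Union>\<C>) W D \<phi>"
    using insert.prems by (intro rooted_density_Un) auto
  then show ?case using insert by simp
qed

lemma rooted_density_image_edges:
  assumes "inj h"
  shows "rooted_density (h ` R) (image_edges h E) W D \<phi> = rooted_density R E W D (\<phi> \<circ> h)"
  unfolding rooted_density_def hom_indicator_image_edges[abs_def] Union_image_edges
    image_set_diff[OF assms, symmetric]
  by (rule avg_comp[OF assms])

lemma rooted_density_avg_roots: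
  assumes "finite (\<Union>E)" "finite L" "finite W" "W \<noteq> {}"
  shows "rooted_density {} E W D = avg L W (rooted_density L E W D)"
proof
  fix \<phi>
  have "avg L W (rooted_density L E W D) = avg (L \<union> (\<Union>E - L)) W (hom_indicator E D)"
    unfolding rooted_density_def using assms by (intro avg_Un[symmetric]) auto
  also have "L \<union> (\<Union>E - L) = (L - \<Union>E) \<union> \<Union>E" by blast
  also have "avg ((L - \<Union>E) \<union> \<Union>E) W (hom_indicator E D) = avg (L - \<Union>E) W (avg (\<Union>E) W (hom_indicator E D))"
    using assms by (intro avg_Un) auto
  finally have "avg L W (rooted_density L E W D) = avg (L - \<Union>E) W (rooted_density {} E W D)"
    by (simp add: rooted_density_def)
  moreover have "avg (L - \<Union>E) W (rooted_density {} E W D) \<phi> = rooted_density {} E W D \<phi>"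
    using assms by (intro avg_eq_self[OF _ _ _ depends_on_rooted_density]) auto
  ultimately show "rooted_density {} E W D \<phi> = avg L W (rooted_density L E W D) \<phi>" by simp
qed

definition rooted_homs :: "'a set \<Rightarrow> 'a set set \<Rightarrow> 'b set \<Rightarrow> 'b set set \<Rightarrow> ('a \<Rightarrow> 'b) \<Rightarrow> ('a \<Rightarrow> 'b) set" where
  "rooted_homs R E W D \<phi> = {\<psi> \<in> \<Union>E - R \<rightarrow>\<^sub>E W. \<forall>e\<in>E. override_on \<phi> \<psi> (\<Union>E - R) ` e \<in> D}"

lemma rooted_density_eq_card:
  assumes "finite (\<Union>E)" "finite W"
  shows "rooted_density R E W D \<phi> = card (rooted_homs R E W D \<phi>) / card (\<Union>E - R \<rightarrow>\<^sub>E W)"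
proof -
  have "finite (\<Union>E - R \<rightarrow>\<^sub>E W)" using assms by (intro finite_PiE) auto
  then show ?thesis
    by (simp add: rooted_density_def rooted_homs_def avg_def hom_indicator_def
        of_bool_def sum.If_cases Int_def)
qed

subsection \<open>Homomorphism densities and the moment matrix\<close>

lemma hom_density_abs:
  assumes "pl_edges E" "finite W"
  shows "hom_density (abs_plgraph E) W D = rooted_density {} E W D \<phi>"
proof -
  have "rooted_density {} E W D \<phi> = rooted_density {} E W D (\<lambda>_. undefined)"
    by (rule depends_onD[OF depends_on_rooted_density]) simp
  also have "\<dots> = (\<Sum>\<psi>\<in>\<Union>E \<rightarrow>\<^sub>E W. hom_indicator E D \<psi>) / card (\<Union>E \<rightarrow>\<^sub>E W)"
    unfolding rooted_density_def Diff_empty by (rule avg_undefined)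
  also have "\<dots> = hom_density (abs_plgraph E) W D"
    using finite_PiE[OF finite_Union_pl_edges[OF assms(1)] assms(2)]
    by (simp add: hom_density.abs_eq[OF pl_iso_refl[OF assms(1)]] hom_indicator_def of_bool_def
        sum.If_cases Int_def)
  finally show ?thesis by simp
qed

lemma hom_density_nonneg: "finite W \<Longrightarrow> hom_density C W D \<ge> 0"
  by (metis abs_rep_plgraph hom_density_abs pl_edges_rep rooted_density_nonneg)

lemma eval_monomial_hom_density:
  assumes "pl_edges E" "finite W"
  shows "eval_monomial (graph_components (abs_plgraph E)) (\<lambda>C. hom_density C W D) =
    rooted_density {} E W D \<phi>"
proof -
  have pl_edges_comp: "pl_edges c" if "c \<in> comps E" for c
    using pl_edges_subset[OF assms(1) comps_subset[OF that]] .
  have "eval_monomial (graph_components (abs_plgraph E)) (\<lambda>C. hom_density C W D)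
      = (\<Prod>c\<in>comps E. hom_density (abs_plgraph c) W D)"
    by (simp add: eval_monomial_def graph_components_abs[OF assms(1)] image_mset.compositionality
        comp_def prod_unfold_prod_mset del: Union_iff)
  also have "\<dots> = (\<Prod>c\<in>comps E. rooted_density {} c W D \<phi>)"
    using hom_density_abs[OF pl_edges_comp assms(2)] by (intro prod.cong refl)
  also have "\<dots> = rooted_density {} (\<Union>(comps E)) W D \<phi>"
    by (rule rooted_density_Union[symmetric])
      (rule finite_comps[OF assms(1)] assms(2) finite_Union_pl_edges[OF pl_edges_comp]
        equalityD1[OF comps_eq_or_disjoint] | assumption)+
  finally show ?thesis using Union_comps[OF assms(1)] by simp
qed

lemma rooted_density_unlabel_glue:
  assumes "pl_edges E" "pl_edges F" "finite W" "W \<noteq> {}"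
    and "finite L" "L \<subseteq> range Lab" "\<Union>E \<inter> range Lab \<subseteq> L" "\<Union>F \<inter> range Lab \<subseteq> L"
  shows "rooted_density {} (image_edges unl (glue_edges E F)) W D \<phi> =
    avg L W (\<lambda>\<phi>. rooted_density L E W D \<phi> * rooted_density L F W D \<phi>) (\<phi> \<circ> unl)"
proof -
  have tag_L: "tag0 ` L = L" "tag1 ` L = L" using assms(6) by force+
  have tag_id: "tag0 v = v" "tag1 v = v" if "v \<in> L" for v
    using that assms(6) by auto
  have only_roots_shared: "tag0 ` \<Union>E \<inter> tag1 ` \<Union>F \<subseteq> L"
  proof
    fix z assume shared_vertex: "z \<in> tag0 ` \<Union>E \<inter> tag1 ` \<Union>F"
    obtain v where preimage_E: "z = tag0 v" "v \<in> \<Union>E" using IntD1[OF shared_vertex] by (rule imageE)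
    obtain w where preimage_F: "z = tag1 w" using IntD2[OF shared_vertex] by (rule imageE)
    obtain i where "v = Lab i" using preimage_E(1) preimage_F tag0_eq_tag1 by metis
    then show "z \<in> L" using preimage_E assms(7) by auto
  qed
  have "rooted_density L (glue_edges E F) W D \<eta> =
      rooted_density (tag0 ` L) (image_edges tag0 E) W D \<eta> *
      rooted_density (tag1 ` L) (image_edges tag1 F) W D \<eta>" for \<eta>
    unfolding glue_edges_def tag_L using assms(1-3) only_roots_shared
    by (intro rooted_density_Un) (simp_all only: Union_image_edges finite_Union_pl_edges finite_imageI)
  also have "\<dots> \<eta> = rooted_density L E W D \<eta> * rooted_density L F W D \<eta>" for \<eta>
    unfolding rooted_density_image_edges[OF tag0_inj] rooted_density_image_edges[OF tag1_inj]
    by (intro arg_cong2[where f = "(*)"] depends_onD[OF depends_on_rooted_density]) (simp_all add: tag_id)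
  finally have product: "rooted_density L (glue_edges E F) W D =
      (\<lambda>\<eta>. rooted_density L E W D \<eta> * rooted_density L F W D \<eta>)" by blast
  have "rooted_density {} (image_edges unl (glue_edges E F)) W D \<phi> =
      rooted_density {} (glue_edges E F) W D (\<phi> \<circ> unl)"
    using rooted_density_image_edges[OF unl_inj, of "{}"] by simp
  also have "\<dots> = avg L W (rooted_density L (glue_edges E F) W D) (\<phi> \<circ> unl)"
    using rooted_density_avg_roots[OF finite_Union_pl_edges[OF pl_edges_glue[OF assms(1,2)]] assms(5,3,4)]
    by simp
  finally show ?thesis unfolding product .
qed

text \<open>The target \<open>D\<close> is allowed to contain singletons, that is, loops.\<close>

abbreviation density_matrix :: "nat set \<Rightarrow> nat set set \<Rightarrow> plgraph \<Rightarrow> plgraph \<Rightarrow> real" where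
  "density_matrix W D A B \<equiv> eval_monomial (moment_matrix A B) (\<lambda>C. hom_density C W D)"

lemma density_matrix_eq_sum:
  assumes "A \<in> basis d l" "B \<in> basis d l" "finite W" "W \<noteq> {}"
  shows "density_matrix W D A B = 1 / card (label_vertices l \<rightarrow>\<^sub>E W) * (\<Sum>\<phi>\<in>label_vertices l \<rightarrow>\<^sub>E W.
    rooted_density (label_vertices l) (rep_plgraph A) W D \<phi> *
    rooted_density (label_vertices l) (rep_plgraph B) W D \<phi>)"
proof -
  let ?L = "label_vertices l" and ?E = "rep_plgraph A" and ?F = "rep_plgraph B"
  have "density_matrix W D (abs_plgraph ?E) (abs_plgraph ?F) =
      rooted_density {} (image_edges unl (glue_edges ?E ?F)) W D (\<lambda>_. undefined)"
    unfolding moment_matrix_abs[OF pl_edges_rep pl_edges_rep]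
    by (intro eval_monomial_hom_density pl_edges_unl pl_edges_glue pl_edges_rep assms)
  also have "\<dots> = avg ?L W (\<lambda>\<phi>. rooted_density ?L ?E W D \<phi> * rooted_density ?L ?F W D \<phi>) (\<lambda>_. undefined)"
    using rooted_density_unlabel_glue[OF pl_edges_rep pl_edges_rep assms(3,4), of ?L A B] assms(1,2)
    by (simp add: basis_rep comp_def image_subset_iff)
  finally show ?thesis
    unfolding avg_undefined abs_rep_plgraph by simp
qed

lemma psd_on_density_matrix:
  assumes "I \<subseteq> basis d l" "finite W" "W \<noteq> {}"
  shows "psd_on I (density_matrix W D)"
proof -
  let ?L = "label_vertices l"
  have entry: "density_matrix W D A B = 1 / card (?L \<rightarrow>\<^sub>E W) * (\<Sum>\<phi>\<in>?L \<rightarrow>\<^sub>E W.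
      rooted_density ?L (rep_plgraph A) W D \<phi> * rooted_density ?L (rep_plgraph B) W D \<phi>)"
    if "A \<in> I" "B \<in> I" for A B
    using density_matrix_eq_sum that assms by blast
  show ?thesis
    by (rule psd_on_cong[THEN iffD2, OF entry psd_on_Gram]) simp_all
qed

lemma strict_density_minor:
  fixes l :: nat
  defines "L \<equiv> label_vertices l"
  assumes basis: "A \<in> basis d l" "B \<in> basis d l" and target: "finite W" "W \<noteq> {}"
    and placements: "\<phi> ` L \<subseteq> W" "\<psi> ` L \<subseteq> W"
    and not_proportional:
      "rooted_density L (rep_plgraph A) W D \<phi> * rooted_density L (rep_plgraph B) W D \<psi> \<noteq>
       rooted_density L (rep_plgraph A) W D \<psi> * rooted_density L (rep_plgraph B) W D \<phi>"
  shows "(density_matrix W D A B)\<^sup>2 < density_matrix W D A A * density_matrix W D B B"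
proof -
  let ?p = "rooted_density L (rep_plgraph A) W D" and ?q = "rooted_density L (rep_plgraph B) W D"
  have density_restrict: "rooted_density L E W D (restrict \<eta> L) = rooted_density L E W D \<eta>" for E \<eta>
    by (rule depends_onD[OF depends_on_rooted_density]) auto
  have "finite (L \<rightarrow>\<^sub>E W)" unfolding L_def using target(1) by (intro finite_PiE) auto
  moreover have "restrict \<phi> L \<in> L \<rightarrow>\<^sub>E W" "restrict \<psi> L \<in> L \<rightarrow>\<^sub>E W" using placements by auto
  ultimately have "(\<Sum>\<eta>\<in>L \<rightarrow>\<^sub>E W. ?p \<eta> * ?q \<eta>)\<^sup>2 <
      (\<Sum>\<eta>\<in>L \<rightarrow>\<^sub>E W. ?p \<eta> * ?p \<eta>) * (\<Sum>\<eta>\<in>L \<rightarrow>\<^sub>E W. ?q \<eta> * ?q \<eta>)"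
    using not_proportional
    by (intro strict_Cauchy_Schwarz_sum[of _ "restrict \<phi> L" "restrict \<psi> L"])
      (simp_all add: density_restrict)
  moreover have "card (L \<rightarrow>\<^sub>E W) > 0" using target by (simp add: L_def card_PiE card_gt_0_iff)
  ultimately show ?thesis
    using density_matrix_eq_sum[OF basis(1,1) target] density_matrix_eq_sum[OF basis(1,2) target]
      density_matrix_eq_sum[OF basis(2,2) target]
    by (simp add: L_def power2_eq_square divide_strict_right_mono)
qed


section \<open>Separating partially labeled graphs by homomorphism counts\<close>

definition label_homs :: "vertex set set \<Rightarrow> vertex set set \<Rightarrow> (vertex \<Rightarrow> vertex) set" where
  "label_homs E F = {\<eta> \<in> extensional (\<Union>E). (\<forall>e\<in>E. \<eta> ` e \<in> F) \<and> (\<forall>i. Lab i \<in> \<Union>E \<longrightarrow> \<eta> (Lab i) = Lab i)}"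

lemma label_homs_edge: "\<eta> \<in> label_homs E F \<Longrightarrow> e \<in> E \<Longrightarrow> \<eta> ` e \<in> F"
  by (simp add: label_homs_def)

lemma label_homs_Lab: "\<eta> \<in> label_homs E F \<Longrightarrow> Lab i \<in> \<Union>E \<Longrightarrow> \<eta> (Lab i) = Lab i"
  unfolding label_homs_def by blast

lemma label_homs_image_subset: "\<eta> \<in> label_homs E F \<Longrightarrow> \<eta> ` \<Union>E \<subseteq> \<Union>F"
  using label_homs_edge by blast

lemma finite_label_homs:
  assumes "pl_edges E" "pl_edges F"
  shows "finite (label_homs E F)"
proof (rule finite_subset)
  show "label_homs E F \<subseteq> \<Union>E \<rightarrow>\<^sub>E \<Union>F"
  proof
    fix \<eta> assume hom: "\<eta> \<in> label_homs E F"
    then have "\<eta> \<in> extensional (\<Union>E)" by (simp add: label_homs_def)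
    then show "\<eta> \<in> \<Union>E \<rightarrow>\<^sub>E \<Union>F"
      using label_homs_image_subset[OF hom] by (simp add: PiE_iff image_subset_iff del: Union_iff)
  qed
  show "finite (\<Union>E \<rightarrow>\<^sub>E \<Union>F)" by (intro finite_PiE finite_Union_pl_edges assms)
qed

definition induced_edges :: "'a set set \<Rightarrow> 'a set \<Rightarrow> 'a set set" where
  "induced_edges F S = {e \<in> F. e \<subseteq> S}"

lemma label_homs_induced_edges: "label_homs E (induced_edges F S) = {\<eta> \<in> label_homs E F. \<eta> ` \<Union>E \<subseteq> S}"
  unfolding label_homs_def induced_edges_def by blast

lemma card_label_homs_by_image:
  assumes "pl_edges E" "pl_edges F" "finite S"
  shows "card (label_homs E (induced_edges F S)) = (\<Sum>T\<in>Pow S. card {\<eta> \<in> label_homs E F. \<eta> ` \<Union>E = T})"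
proof -
  have "label_homs E (induced_edges F S) = (\<Union>T\<in>Pow S. {\<eta> \<in> label_homs E F. \<eta> ` \<Union>E = T})"
    unfolding label_homs_induced_edges by (intro set_eqI) (simp del: Union_iff image_subset_iff)
  then show ?thesis
    using assms finite_label_homs by (simp only:) (intro card_UN_disjoint; auto)
qed

text \<open>Lovasz' argument: by inclusion-exclusion the numbers of homomorphisms into all induced subgraphs
  determine the number of surjective ones.\<close>

lemma exists_surjective_label_hom:
  assumes "pl_edges E" "pl_edges F"
    and "\<And>S. finite S \<Longrightarrow>
      card (label_homs E (induced_edges F S)) = card (label_homs F (induced_edges F S))"
  obtains \<eta> where "\<eta> \<in> label_homs E F" "\<eta> ` \<Union>E = \<Union>F"
proof -
  define onto where "onto G T = {\<eta> \<in> label_homs G F. \<eta> ` \<Union>G = T}" for G T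
  define into where "into S = int (card (label_homs F (induced_edges F S)))" for S
  have "into S = (\<Sum>T\<in>Pow S. int (card (onto G T)))" if "finite S" "G \<in> {E, F}" for G S
    using that assms card_label_homs_by_image[of G F S] by (auto simp: into_def onto_def)
  then have "int (card (onto G (\<Union>F))) =
      (\<Sum>T\<in>Pow (\<Union>F). (- 1) ^ (card (\<Union>F) - card T) * into T)" if "G \<in> {E, F}" for G
    using that by (intro inclusion_exclusion_mobius finite_Union_pl_edges assms(2)) auto
  then have "card (onto E (\<Union>F)) = card (onto F (\<Union>F))" by (metis insertCI of_nat_eq_iff)
  moreover have "card (onto F (\<Union>F)) > 0"
  proof -
    have "restrict id (\<Union>F) ` e = e" if "e \<in> F" for e using that by force
    then have "restrict id (\<Union>F) \<in> onto F (\<Union>F)" by (auto simp: onto_def label_homs_def)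
    moreover have "finite (onto F (\<Union>F))"
      using finite_label_homs[OF assms(2,2)] by (simp add: onto_def)
    ultimately show ?thesis by (auto simp: card_gt_0_iff)
  qed
  ultimately have "onto E (\<Union>F) \<noteq> {}" by (metis card.empty less_irrefl)
  then show thesis using that by (auto simp: onto_def)
qed

lemma abs_plgraph_eq_of_surjective_label_homs:
  assumes pl_edges_E: "pl_edges E" and pl_edges_F: "pl_edges F"
    and g_onto: "g \<in> label_homs E F" "g ` \<Union>E = \<Union>F" and h_onto: "h \<in> label_homs F E" "h ` \<Union>F = \<Union>E"
  shows "abs_plgraph E = abs_plgraph F"
proof -
  have finite_parts: "finite (\<Union>E)" "finite (\<Union>F)" "finite E" "finite F"
    using finite_Union_pl_edges pl_edges_E pl_edges_F by (auto simp: pl_edges_def)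
  have "card (\<Union>F) = card (\<Union>E)"
    using card_image_le[OF finite_parts(1), of g] card_image_le[OF finite_parts(2), of h]
      g_onto(2) h_onto(2) by simp
  then have inj: "inj_on g (\<Union>E)" "inj_on h (\<Union>F)"
    using eq_card_imp_inj_on[OF finite_parts(1), of g] eq_card_imp_inj_on[OF finite_parts(2), of h]
      g_onto(2) h_onto(2) by simp_all
  have "card F \<le> card E"
    using card_inj_on_le[OF inj_on_image[OF inj(2)]] label_homs_edge[OF h_onto(1)] finite_parts by blast
  moreover have "card (image_edges g E) = card E" by (rule card_image[OF inj_on_image[OF inj(1)]])
  moreover have "image_edges g E \<subseteq> F" using label_homs_edge[OF g_onto(1)] by blast
  ultimately have edges: "image_edges g E = F" using finite_parts by (intro card_seteq) simp_all
  have "g v = Lab i \<longleftrightarrow> v = Lab i" if vertex: "v \<in> \<Union>E" for v i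
  proof
    assume labeled_image: "g v = Lab i"
    then have "Lab i \<in> \<Union>F" using vertex g_onto(2) by (metis imageI)
    then have "Lab i \<in> \<Union>E" using label_homs_Lab[OF h_onto(1)] h_onto(2) by (metis imageI)
    then show "v = Lab i"
      using inj_onD[OF inj(1) _ vertex] labeled_image label_homs_Lab[OF g_onto(1)] by metis
  qed (use label_homs_Lab[OF g_onto(1)] vertex in metis)
  then have "abs_plgraph (image_edges g E) = abs_plgraph E"
    by (rule abs_plgraph_image_edges(2)[OF pl_edges_E inj(1)])
  then show ?thesis unfolding edges by simp
qed

fun vertex_code :: "vertex \<Rightarrow> nat" where
  "vertex_code (Lab i) = 2 * i + 1"
| "vertex_code (Unl j) = 2 * j + 2"

lemma inj_vertex_code: "inj vertex_code"
  by (rule injI, rename_tac x y, case_tac x; case_tac y; simp; presburger)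

lemma vertex_code_nonzero: "vertex_code v \<noteq> 0"
  by (cases v) auto

text \<open>Mapping all labels to the isolated looped vertex \<open>0\<close> admits exactly one extension, which
  normalises the comparison of two rooted densities.\<close>

definition pointed_target :: "vertex set set \<Rightarrow> nat set set" where
  "pointed_target F = insert {0} (image_edges vertex_code F)"

lemma pointed_target_zero: "e \<in> pointed_target F \<Longrightarrow> 0 \<in> e \<Longrightarrow> e = {0}"
  unfolding pointed_target_def by (metis vertex_code_nonzero imageE insertE)

lemma hom_pointed_target_reach:
  assumes "\<forall>e\<in>E. \<eta> ` e \<in> pointed_target F" "(u, v) \<in> reach E"
  shows "\<eta> u = 0 \<longleftrightarrow> \<eta> v = 0"
  using assms(2) unfolding reach_def
proof (induction rule: rtrancl_induct)
  case (step y z)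
  then have "\<eta> ` {y, z} \<in> pointed_target F" using assms(1) by blast
  then have "0 \<in> {\<eta> y, \<eta> z} \<Longrightarrow> {\<eta> y, \<eta> z} = {0}"
    using pointed_target_zero[of "{\<eta> y, \<eta> z}" F] by simp
  then have "\<eta> y = 0 \<longleftrightarrow> \<eta> z = 0" by (metis insertCI singletonD)
  then show ?case using step.IH by simp
qed simp

lemma hom_pointed_target_nonzero:
  assumes rooted: "pl_edges E" "label_rooted E" and hom: "\<forall>e\<in>E. \<eta> ` e \<in> pointed_target F"
    and labels: "\<And>i. Lab i \<in> \<Union>E \<Longrightarrow> \<eta> (Lab i) \<noteq> 0" and edge: "e \<in> E"
  shows "\<eta> ` e \<in> image_edges vertex_code F"
proof -
  obtain v where endpoint: "v \<in> e" using pl_edges_nonempty[OF rooted(1) edge] by blast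
  then have v_vertex: "v \<in> \<Union>E" using edge by blast
  then obtain i where to_label: "(v, Lab i) \<in> reach E" using rooted(2) unfolding label_rooted_def by blast
  then have "\<eta> (Lab i) \<noteq> 0" using labels reach_Union[OF to_label v_vertex] by blast
  then have "\<eta> v \<noteq> 0" using hom_pointed_target_reach[OF hom to_label] by simp
  then have "\<eta> ` e \<noteq> {0}" using endpoint by (metis imageI singletonD)
  then show ?thesis using bspec[OF hom edge] unfolding pointed_target_def by (metis insertE)
qed

lemma rooted_homs_pointed_target_zero:
  assumes rooted: "pl_edges E" "label_rooted E" "\<Union>E \<inter> range Lab \<subseteq> L" and loop_vertex: "0 \<in> W"
  shows "rooted_homs L E W (pointed_target F) (\<lambda>_. 0) = {\<lambda>v\<in>\<Union>E - L. 0}"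
proof -
  let ?U = "\<Union>E - L"
  have "\<psi> = (\<lambda>v\<in>?U. 0)" if "\<psi> \<in> rooted_homs L E W (pointed_target F) (\<lambda>_. 0)" for \<psi>
  proof (rule PiE_ext[of _ ?U "\<lambda>_. W"])
    have hom: "\<forall>e\<in>E. override_on (\<lambda>_. 0) \<psi> ?U ` e \<in> pointed_target F"
      using that by (simp add: rooted_homs_def)
    fix v assume unlabeled: "v \<in> ?U"
    then obtain i where to_label: "(v, Lab i) \<in> reach E" using rooted(2) unfolding label_rooted_def by blast
    then have "Lab i \<notin> ?U" using reach_Union[OF to_label] unlabeled rooted(3) by blast
    then have "override_on (\<lambda>_. 0) \<psi> ?U v = 0" using hom_pointed_target_reach[OF hom to_label] by simp
    then show "\<psi> v = (\<lambda>v\<in>?U. 0) v" using unlabeled by simp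
  qed (use that loop_vertex in \<open>auto simp: rooted_homs_def\<close>)
  moreover have "(\<lambda>v\<in>?U. 0) \<in> rooted_homs L E W (pointed_target F) (\<lambda>_. 0)"
  proof -
    have "override_on (\<lambda>_. 0) (\<lambda>v\<in>?U. 0 :: nat) ?U = (\<lambda>_. 0)" by (auto simp: override_on_def)
    then show ?thesis
      using loop_vertex pl_edges_nonempty[OF rooted(1)]
      by (auto simp: rooted_homs_def pointed_target_def image_constant_conv)
  qed
  ultimately show ?thesis by blast
qed

definition encode_hom :: "vertex set \<Rightarrow> vertex set set \<Rightarrow> (vertex \<Rightarrow> vertex) \<Rightarrow> vertex \<Rightarrow> nat" where
  "encode_hom L E \<eta> = restrict (vertex_code \<circ> \<eta>) (\<Union>E - L)"

definition decode_hom :: "vertex set \<Rightarrow> vertex set set \<Rightarrow> (vertex \<Rightarrow> nat) \<Rightarrow> vertex \<Rightarrow> vertex" where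
  "decode_hom L E \<psi> = restrict (inv vertex_code \<circ> override_on vertex_code \<psi> (\<Union>E - L)) (\<Union>E)"

lemma override_on_encode_hom:
  assumes "\<eta> \<in> label_homs E F" "L \<subseteq> range Lab" "v \<in> \<Union>E"
  shows "override_on vertex_code (encode_hom L E \<eta>) (\<Union>E - L) v = vertex_code (\<eta> v)"
proof (cases "v \<in> \<Union>E - L")
  case True
  then show ?thesis by (simp add: encode_hom_def)
next
  case False
  then have "v \<in> range Lab" using assms(2,3) by blast
  then have "\<eta> v = v" using label_homs_Lab[OF assms(1)] assms(3) by (metis imageE)
  then show ?thesis using False by simp
qed

lemma encode_hom_in_rooted_homs:
  assumes "\<eta> \<in> label_homs E F" "L \<subseteq> range Lab" "vertex_code ` \<Union>F \<subseteq> W"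
  shows "encode_hom L E \<eta> \<in> rooted_homs L E W (pointed_target F) vertex_code"
proof -
  have "override_on vertex_code (encode_hom L E \<eta>) (\<Union>E - L) ` e = vertex_code ` \<eta> ` e" if "e \<in> E" for e
    unfolding image_image using override_on_encode_hom[OF assms(1,2)] that by (intro image_cong) auto
  then have "\<forall>e\<in>E. override_on vertex_code (encode_hom L E \<eta>) (\<Union>E - L) ` e \<in> pointed_target F"
    using label_homs_edge[OF assms(1)] by (simp add: pointed_target_def)
  moreover have "vertex_code (\<eta> v) \<in> W" if "v \<in> \<Union>E" for v
    using subsetD[OF label_homs_image_subset[OF assms(1)] imageI[OF that]] assms(3)
    by (metis imageI subsetD)
  then have "encode_hom L E \<eta> \<in> \<Union>E - L \<rightarrow>\<^sub>E W" by (auto simp: encode_hom_def simp del: Union_iff)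
  ultimately show ?thesis by (simp add: rooted_homs_def)
qed

lemma rooted_homs_pointed_target_edge:
  assumes "pl_edges E" "label_rooted E" "\<Union>E \<inter> range Lab \<subseteq> L"
    and "\<psi> \<in> rooted_homs L E W (pointed_target F) vertex_code" "e \<in> E"
  shows "override_on vertex_code \<psi> (\<Union>E - L) ` e \<in> image_edges vertex_code F"
proof (rule hom_pointed_target_nonzero[OF assms(1,2) _ _ assms(5)])
  show "\<forall>e\<in>E. override_on vertex_code \<psi> (\<Union>E - L) ` e \<in> pointed_target F"
    using assms(4) by (simp add: rooted_homs_def)
  fix i assume "Lab i \<in> \<Union>E"
  then have "Lab i \<notin> \<Union>E - L" using assms(3) by blast
  then show "override_on vertex_code \<psi> (\<Union>E - L) (Lab i) \<noteq> 0" by (simp add: vertex_code_nonzero)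
qed

lemma vertex_code_decode_hom:
  assumes "pl_edges E" "label_rooted E" "\<Union>E \<inter> range Lab \<subseteq> L"
    and "\<psi> \<in> rooted_homs L E W (pointed_target F) vertex_code" "v \<in> \<Union>E"
  shows "vertex_code (decode_hom L E \<psi> v) = override_on vertex_code \<psi> (\<Union>E - L) v"
proof -
  obtain e where edge: "e \<in> E" "v \<in> e" using assms(5) by blast
  obtain e' where "override_on vertex_code \<psi> (\<Union>E - L) ` e = vertex_code ` e'"
    using rooted_homs_pointed_target_edge[OF assms(1-4) edge(1)] by (rule imageE)
  then have "override_on vertex_code \<psi> (\<Union>E - L) v \<in> vertex_code ` e'" using edge(2) by (metis imageI)
  then have "override_on vertex_code \<psi> (\<Union>E - L) v \<in> range vertex_code" by blast
  then show ?thesis using assms(5) by (simp add: decode_hom_def f_inv_into_f del: Union_iff)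
qed

lemma decode_hom_in_label_homs:
  assumes "pl_edges E" "label_rooted E" "\<Union>E \<inter> range Lab \<subseteq> L"
    and "\<psi> \<in> rooted_homs L E W (pointed_target F) vertex_code"
  shows "decode_hom L E \<psi> \<in> label_homs E F"
proof -
  have "decode_hom L E \<psi> ` e \<in> F" if edge: "e \<in> E" for e
  proof -
    have "vertex_code ` decode_hom L E \<psi> ` e = override_on vertex_code \<psi> (\<Union>E - L) ` e"
      unfolding image_image using vertex_code_decode_hom[OF assms] edge by (intro image_cong) auto
    then obtain e' where "vertex_code ` decode_hom L E \<psi> ` e = vertex_code ` e'" "e' \<in> F"
      using rooted_homs_pointed_target_edge[OF assms edge] by auto
    then show ?thesis by (simp add: inj_image_eq_iff[OF inj_vertex_code])
  qed
  moreover have "decode_hom L E \<psi> (Lab i) = Lab i" if "Lab i \<in> \<Union>E" for i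
  proof -
    have "Lab i \<notin> \<Union>E - L" using that assms(3) by blast
    then have "vertex_code (decode_hom L E \<psi> (Lab i)) = vertex_code (Lab i)"
      unfolding vertex_code_decode_hom[OF assms that] by (rule override_on_apply_notin)
    then show ?thesis by (rule injD[OF inj_vertex_code])
  qed
  ultimately show ?thesis by (simp add: label_homs_def decode_hom_def)
qed

lemma card_rooted_homs_pointed_target:
  assumes rooted: "pl_edges E" "label_rooted E" "\<Union>E \<inter> range Lab \<subseteq> L"
    and only_labels: "L \<subseteq> range Lab" and target: "vertex_code ` \<Union>F \<subseteq> W"
  shows "card (rooted_homs L E W (pointed_target F) vertex_code) = card (label_homs E F)"
proof -
  have "bij_betw (encode_hom L E) (label_homs E F) (rooted_homs L E W (pointed_target F) vertex_code)"
  proof (rule bij_betw_byWitness[where f' = "decode_hom L E"])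
    show "\<forall>\<eta>\<in>label_homs E F. decode_hom L E (encode_hom L E \<eta>) = \<eta>"
    proof (intro ballI ext)
      fix \<eta> v assume hom: "\<eta> \<in> label_homs E F"
      show "decode_hom L E (encode_hom L E \<eta>) v = \<eta> v"
        using override_on_encode_hom[OF hom only_labels, of v] hom inv_f_f[OF inj_vertex_code]
        by (auto simp: decode_hom_def label_homs_def extensional_def simp del: Union_iff)
    qed
    show "\<forall>\<psi>\<in>rooted_homs L E W (pointed_target F) vertex_code. encode_hom L E (decode_hom L E \<psi>) = \<psi>"
    proof (intro ballI ext)
      fix \<psi> v assume hom: "\<psi> \<in> rooted_homs L E W (pointed_target F) vertex_code"
      show "encode_hom L E (decode_hom L E \<psi>) v = \<psi> v"
        using vertex_code_decode_hom[OF rooted hom, of v] hom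
        by (cases "v \<in> \<Union>E - L") (auto simp: encode_hom_def rooted_homs_def PiE_iff extensional_def
            simp del: Union_iff)
    qed
  qed (use encode_hom_in_rooted_homs[OF _ only_labels target] decode_hom_in_label_homs[OF rooted] in blast)+
  then show ?thesis by (rule bij_betw_same_card[symmetric])
qed

lemma rooted_density_pointed_target:
  assumes rooted: "pl_edges E" "label_rooted E" "\<Union>E \<inter> range Lab \<subseteq> L" and only_labels: "L \<subseteq> range Lab"
    and target: "finite W" "0 \<in> W" "vertex_code ` \<Union>F \<subseteq> W"
  shows "rooted_density L E W (pointed_target F) (\<lambda>_. 0) = 1 / card (\<Union>E - L \<rightarrow>\<^sub>E W)"
    and "rooted_density L E W (pointed_target F) vertex_code = card (label_homs E F) / card (\<Union>E - L \<rightarrow>\<^sub>E W)"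
  using rooted_homs_pointed_target_zero[OF rooted target(2)]
    card_rooted_homs_pointed_target[OF rooted only_labels target(3)]
  by (simp_all add: rooted_density_eq_card[OF finite_Union_pl_edges[OF rooted(1)] target(1)])

lemma strict_density_minor_of_counts:
  assumes reduced: "A \<in> reduced_basis d l" "B \<in> reduced_basis d l" and pl_edges_F: "pl_edges F"
    and counts: "card (label_homs (rep_plgraph A) F) \<noteq> card (label_homs (rep_plgraph B) F)"
  obtains W D where "finite W" "0 \<in> W" "{0} \<in> D"
    and "(density_matrix W D A B)\<^sup>2 < density_matrix W D A A * density_matrix W D B B"
proof
  let ?L = "label_vertices l" and ?E = "rep_plgraph A" and ?E' = "rep_plgraph B"
  let ?W = "insert 0 (vertex_code ` (?L \<union> \<Union>F))" and ?D = "pointed_target F"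
  have target: "finite ?W" "0 \<in> ?W" "vertex_code ` \<Union>F \<subseteq> ?W" "vertex_code ` ?L \<subseteq> ?W" "(\<lambda>_. 0) ` ?L \<subseteq> ?W"
    using finite_Union_pl_edges[OF pl_edges_F] by auto
  have basis: "A \<in> basis d l" "B \<in> basis d l" using reduced reduced_basis_subset by blast+
  then have labels: "\<Union>?E \<inter> range Lab \<subseteq> ?L" "\<Union>?E' \<inter> range Lab \<subseteq> ?L" unfolding basis_rep by blast+
  have only_labels: "?L \<subseteq> range Lab" by blast
  note densities =
    rooted_density_pointed_target[OF pl_edges_rep label_rooted_rep[OF reduced(1)] labels(1)
      only_labels target(1-3)]
    rooted_density_pointed_target[OF pl_edges_rep label_rooted_rep[OF reduced(2)] labels(2)
      only_labels target(1-3)]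
  have "card (\<Union>(rep_plgraph C) - ?L \<rightarrow>\<^sub>E ?W) > 0" for C
    using finite_Union_pl_edges[OF pl_edges_rep] target(1) by (simp add: card_PiE card_gt_0_iff)
  from this[of A] this[of B]
  have "rooted_density ?L ?E ?W ?D (\<lambda>_. 0) * rooted_density ?L ?E' ?W ?D vertex_code \<noteq>
      rooted_density ?L ?E ?W ?D vertex_code * rooted_density ?L ?E' ?W ?D (\<lambda>_. 0)"
    using counts unfolding densities by (simp add: field_simps)
  then show "(density_matrix ?W ?D A B)\<^sup>2 < density_matrix ?W ?D A A * density_matrix ?W ?D B B"
    by (rule strict_density_minor[OF basis target(1) insert_not_empty target(5,4)])
qed (use finite_Union_pl_edges[OF pl_edges_F] in \<open>auto simp: pointed_target_def\<close>)

lemma label_hom_counts_separate: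
  assumes "A \<noteq> B"
  shows "\<exists>F. pl_edges F \<and> card (label_homs (rep_plgraph A) F) \<noteq> card (label_homs (rep_plgraph B) F)"
proof (rule ccontr)
  let ?E = "rep_plgraph A" and ?F = "rep_plgraph B"
  assume "\<not> ?thesis"
  then have counts: "card (label_homs ?E (induced_edges F S)) = card (label_homs ?F (induced_edges F S))"
    if "pl_edges F" for F S
    using pl_edges_subset[OF that, of "induced_edges F S"] by (auto simp: induced_edges_def)
  obtain g where "g \<in> label_homs ?E ?F" "g ` \<Union>?E = \<Union>?F"
    using exists_surjective_label_hom[OF pl_edges_rep pl_edges_rep counts[OF pl_edges_rep]] .
  moreover obtain h where "h \<in> label_homs ?F ?E" "h ` \<Union>?F = \<Union>?E"
    using exists_surjective_label_hom[OF pl_edges_rep pl_edges_rep counts[OF pl_edges_rep, symmetric]] .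
  ultimately have "abs_plgraph ?E = abs_plgraph ?F"
    by (rule abs_plgraph_eq_of_surjective_label_homs[OF pl_edges_rep pl_edges_rep])
  then show False using assms by (simp add: abs_rep_plgraph)
qed

lemma hom_density_pos:
  assumes "finite W" "w \<in> W" "{w} \<in> D"
  shows "hom_density C W D > 0"
proof -
  let ?E = "rep_plgraph C"
  let ?\<psi> = "\<lambda>v\<in>\<Union>?E - {}. w"
  have finite_maps: "finite (\<Union>?E - {} \<rightarrow>\<^sub>E W)"
    by (intro finite_PiE finite_Diff finite_Union_pl_edges pl_edges_rep assms)
  have "override_on undefined ?\<psi> (\<Union>?E - {}) ` e = {w}" if "e \<in> ?E" for e
  proof -
    have "override_on undefined ?\<psi> (\<Union>?E - {}) ` e = (\<lambda>_. w) ` e"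
      using that by (intro image_cong refl) (auto simp: override_on_def)
    then show ?thesis using pl_edges_nonempty[OF pl_edges_rep that] by auto
  qed
  then have "?\<psi> \<in> rooted_homs {} ?E W D undefined" using assms(2,3) by (auto simp: rooted_homs_def)
  moreover have "rooted_homs {} ?E W D undefined \<subseteq> \<Union>?E - {} \<rightarrow>\<^sub>E W" by (auto simp: rooted_homs_def)
  ultimately have "card (rooted_homs {} ?E W D undefined) > 0" "card (\<Union>?E - {} \<rightarrow>\<^sub>E W) > 0"
    using finite_subset[OF _ finite_maps] finite_maps by (auto simp: card_gt_0_iff)
  then have "rooted_density {} ?E W D undefined > 0"
    unfolding rooted_density_eq_card[OF finite_Union_pl_edges[OF pl_edges_rep] assms(1)] by simp
  then show ?thesis
    using hom_density_abs[OF pl_edges_rep assms(1), of C D undefined] by (simp add: abs_rep_plgraph)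
qed


section \<open>Tropicalization of positive semidefinite monomial matrices\<close>

definition log_minor :: "('i \<Rightarrow> 'i \<Rightarrow> 'v multiset) \<Rightarrow> 'i \<Rightarrow> 'i \<Rightarrow> ('v \<Rightarrow> real) \<Rightarrow> real" where
  "log_minor M i j y = (\<Sum>C\<in>#M i i + M j j. y C) - (\<Sum>C\<in>#M i j + M j i. y C)"

lemma log_minor_add: "log_minor M i j (\<lambda>C. y C + z C) = log_minor M i j y + log_minor M i j z"
  by (simp add: log_minor_def sum_mset.distrib)

lemma log_minor_cmult: "log_minor M i j (\<lambda>C. c * y C) = c * log_minor M i j y"
  by (simp add: log_minor_def sum_mset_distrib_left[symmetric] algebra_simps)

lemma log_minor_sum:
  "finite A \<Longrightarrow> log_minor M i j (\<lambda>C. \<Sum>a\<in>A. y a C) = (\<Sum>a\<in>A. log_minor M i j (y a))"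
  by (induction A rule: finite_induct) (simp_all add: log_minor_add, simp add: log_minor_def)

lemma sum_mset_eq_sum_count:
  fixes y :: "'v \<Rightarrow> real"
  assumes "finite V" "set_mset m \<subseteq> V"
  shows "(\<Sum>C\<in>#m. y C) = (\<Sum>C\<in>V. real (count m C) * y C)"
  using assms(2)
proof (induction m)
  case (add D m)
  have "(\<Sum>C\<in>V. real (count (add_mset D m) C) * y C) =
      (\<Sum>C\<in>V. real (count m C) * y C + (if C = D then y D else 0))"
    by (intro sum.cong refl) (auto simp: algebra_simps)
  also have "\<dots> = (\<Sum>C\<in>V. real (count m C) * y C) + y D"
    using assms(1) add.prems by (simp add: sum.distrib)
  finally show ?case using add by simp
qed simp

lemma eval_monomial_union: "eval_monomial (m + m') v = eval_monomial m v * eval_monomial m' v"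
  by (simp add: eval_monomial_def)

lemma eval_monomial_cong:
  "(\<And>C. C \<in># m \<Longrightarrow> v C = w C) \<Longrightarrow> eval_monomial m v = eval_monomial m w"
  unfolding eval_monomial_def by (intro arg_cong[where f = prod_mset] image_mset_cong)

lemma eval_monomial_exp:
  assumes "\<And>C. C \<in># m \<Longrightarrow> v C = exp (y C)"
  shows "eval_monomial m v = exp (\<Sum>C\<in>#m. y C)"
  using assms by (induction m) (simp_all add: eval_monomial_def exp_add)

lemma polynomial_fun_eval_monomial:
  "set_mset m \<subseteq> V \<Longrightarrow> polynomial_fun V (eval_monomial m)"
  by (induction m)
    (auto simp: eval_monomial_def[abs_def]
      intro: polynomial_fun_const polynomial_fun_var polynomial_fun_mult)

lemma continuous_map_eval_monomial:
  "set_mset m \<subseteq> V \<Longrightarrow> continuous_map (powertop_real V) euclideanreal (eval_monomial m)"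
  by (induction m)
    (auto simp: eval_monomial_def[abs_def]
      intro!: continuous_map_real_mult continuous_map_product_projection)

lemma log_set_eq: "log_set V S = {y \<in> V \<rightarrow>\<^sub>E UNIV. (\<lambda>C\<in>V. exp (y C)) \<in> S}"
proof (intro equalityI subsetI)
  fix y assume "y \<in> log_set V S"
  then obtain v where preimage: "v \<in> S" "v \<in> pos_orthant V" "y = (\<lambda>C\<in>V. ln (v C))"
    by (auto simp: log_set_def)
  have "(\<lambda>C\<in>V. exp (y C)) = v"
    using preimage(2) by (fastforce simp: preimage(3) pos_orthant_def fun_eq_iff PiE_iff extensional_def)
  then show "y \<in> {y \<in> V \<rightarrow>\<^sub>E UNIV. (\<lambda>C\<in>V. exp (y C)) \<in> S}" using preimage by auto
next
  fix y assume exp_in_S: "y \<in> {y \<in> V \<rightarrow>\<^sub>E UNIV. (\<lambda>C\<in>V. exp (y C)) \<in> S}"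
  then have "y = (\<lambda>C\<in>V. ln ((\<lambda>C\<in>V. exp (y C)) C))"
    by (auto simp: fun_eq_iff PiE_iff extensional_def)
  moreover have "(\<lambda>C\<in>V. exp (y C)) \<in> S \<inter> pos_orthant V" using exp_in_S by (auto simp: pos_orthant_def)
  ultimately show "y \<in> log_set V S" unfolding log_set_def by (rule image_eqI)
qed

lemma log_set_mono: "S \<subseteq> T \<Longrightarrow> log_set V S \<subseteq> log_set V T"
  unfolding log_set_def by blast

lemma trop_subset_cone:
  assumes cone: "rational_polyhedral_cone V K" and log_subset: "log_set V S \<subseteq> K"
  shows "trop V S \<subseteq> K"
proof
  fix y assume "y \<in> trop V S"
  then obtain \<tau> w where base: "\<And>k. \<tau> k \<in> {0<..<1}" and points: "\<And>k. w k \<in> S \<inter> pos_orthant V"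
    and limit: "limitin (powertop_real V) (\<lambda>k. \<lambda>C\<in>V. (- 1 / ln (\<tau> k)) * ln (w k C)) y sequentially"
    by (auto simp: trop_def)
  obtain F :: "(plgraph \<Rightarrow> rat) set"
    where halfspaces: "K = {y \<in> V \<rightarrow>\<^sub>E UNIV. \<forall>c\<in>F. (\<Sum>C\<in>V. of_rat (c C) * y C) \<ge> 0}"
    using cone unfolding rational_polyhedral_cone_def by blast
  have coordinates: "(\<lambda>k. (- 1 / ln (\<tau> k)) * ln (w k C)) \<longlonglongrightarrow> y C" if "C \<in> V" for C
    using limit that unfolding limitin_componentwise by auto
  have "(\<Sum>C\<in>V. of_rat (c C) * y C) \<ge> 0" if constraint: "c \<in> F" for c
  proof (rule LIMSEQ_le_const)
    show "(\<lambda>k. \<Sum>C\<in>V. of_rat (c C) * ((- 1 / ln (\<tau> k)) * ln (w k C))) \<longlonglongrightarrow> (\<Sum>C\<in>V. of_rat (c C) * y C)"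
      by (intro tendsto_sum tendsto_mult tendsto_const coordinates)
    have "(\<Sum>C\<in>V. of_rat (c C) * ((- 1 / ln (\<tau> k)) * ln (w k C))) \<ge> 0" for k
    proof -
      have "(\<lambda>C\<in>V. ln (w k C)) \<in> K" using log_subset points[of k] unfolding log_set_def by blast
      then have "(\<Sum>C\<in>V. of_rat (c C) * ln (w k C)) \<ge> 0" using constraint halfspaces by auto
      moreover have "- 1 / ln (\<tau> k) \<ge> 0" using base[of k] by (simp add: divide_nonpos_nonpos)
      ultimately have "(- 1 / ln (\<tau> k)) * (\<Sum>C\<in>V. of_rat (c C) * ln (w k C)) \<ge> 0"
        by (intro mult_nonneg_nonneg)
      then show ?thesis by (simp only: sum_distrib_left mult.left_commute)
    qed
    then show "\<exists>N. \<forall>k\<ge>N. 0 \<le> (\<Sum>C\<in>V. of_rat (c C) * ((- 1 / ln (\<tau> k)) * ln (w k C)))" by blast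
  qed
  then show "y \<in> K" using limitin_topspace[OF limit] halfspaces by simp
qed

lemma trop_limit_of_rays:
  assumes extensional: "y \<in> V \<rightarrow>\<^sub>E UNIV" and limit: "\<And>C. C \<in> V \<Longrightarrow> (\<lambda>k. z k C) \<longlonglongrightarrow> y C"
    and rays: "\<And>k. \<forall>\<^sub>F s in at_top. (\<lambda>C\<in>V. exp (s * z k C)) \<in> S"
  shows "y \<in> trop V S"
proof -
  have "\<exists>s\<ge>real (Suc k). (\<lambda>C\<in>V. exp (s * z k C)) \<in> S" for k
    using eventually_happens'[OF _ eventually_conj[OF eventually_ge_at_top[of "real (Suc k)"] rays[of k]]]
    by auto
  then obtain s where scales: "\<And>k. s k \<ge> real (Suc k)" "\<And>k. (\<lambda>C\<in>V. exp (s k * z k C)) \<in> S"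
    by metis
  have s_pos: "s k > 0" for k using scales(1)[of k] by linarith
  let ?w = "\<lambda>k. \<lambda>C\<in>V. exp (s k * z k C)"
  show ?thesis
    unfolding trop_def
  proof (intro CollectI exI conjI allI)
    show "exp (- s k) \<in> {0<..<1}" for k using s_pos[of k] by simp
    have "filterlim (\<lambda>k. real (Suc k)) at_top sequentially"
      using filterlim_compose[OF filterlim_real_sequentially filterlim_Suc] .
    then have "filterlim s at_top sequentially"
      by (rule filterlim_at_top_mono) (use scales(1) in simp)
    then show "(\<lambda>k. exp (- s k)) \<longlonglongrightarrow> 0"
      by (intro filterlim_compose[OF exp_at_bot] filterlim_compose[OF filterlim_uminus_at_bot_at_top])
    show "?w k \<in> S \<inter> pos_orthant V" for k using scales(2)[of k] by (auto simp: pos_orthant_def)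
    have "(\<lambda>k. (\<lambda>C\<in>V. (- 1 / ln (exp (- s k))) * ln (?w k C)) C) \<longlonglongrightarrow> y C" if "C \<in> V" for C
      using limit[OF that] that s_pos by (simp add: less_imp_neq[symmetric])
    then show "limitin (powertop_real V) (\<lambda>k. \<lambda>C\<in>V. (- 1 / ln (exp (- s k))) * ln (?w k C)) y sequentially"
      unfolding limitin_componentwise using extensional by (auto simp: PiE_iff)
  qed
qed

definition monomial_minor ::
  "('i \<Rightarrow> 'i \<Rightarrow> plgraph multiset) \<Rightarrow> 'i \<Rightarrow> 'i \<Rightarrow> (plgraph \<Rightarrow> real) \<Rightarrow> real" where
  "monomial_minor M i j v = eval_monomial (M i i) v * eval_monomial (M j j) v
     - eval_monomial (M i j) v * eval_monomial (M j i) v"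

definition psd_profile ::
  "plgraph set \<Rightarrow> 'i set \<Rightarrow> ('i \<Rightarrow> 'i \<Rightarrow> plgraph multiset) \<Rightarrow> (plgraph \<Rightarrow> real) set" where
  "psd_profile V I M = {v \<in> nonneg_orthant V. psd_on I (\<lambda>i j. eval_monomial (M i j) v)}"

locale monomial_matrix =
  fixes V :: "plgraph set" and I :: "'i set" and M :: "'i \<Rightarrow> 'i \<Rightarrow> plgraph multiset"
  assumes finite_vars: "finite V" and finite_index: "finite I"
    and entry_vars: "i \<in> I \<Longrightarrow> j \<in> I \<Longrightarrow> set_mset (M i j) \<subseteq> V"
    and symmetric: "symmetric_on I M"
begin

lemma symmetric_eval: "symmetric_on I (\<lambda>i j. eval_monomial (M i j) v)"
  using symmetric by (simp add: symmetric_on_def)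

lemma basic_semialgebraic_psd_profile: "basic_semialgebraic V (psd_profile V I M)"
  unfolding psd_profile_def
  by (intro basic_semialgebraic_polynomial_condition polynomial_condition_psd_on
      finite_index polynomial_fun_eval_monomial entry_vars symmetric_eval)

lemma closedin_psd_profile: "closedin (powertop_real V) (psd_profile V I M)"
proof -
  let ?q = "\<lambda>x v. quadratic_form I (\<lambda>i j. eval_monomial (M i j) v) x"
  let ?T = "(\<lambda>C v. v C) ` V \<union> range ?q"
  have "continuous_map (powertop_real V) euclideanreal (?q x)" for x
    unfolding quadratic_form_def
    by (intro continuous_map_sum continuous_map_real_mult continuous_map_eval_monomial
        entry_vars finite_index) auto
  then have "continuous_map (powertop_real V) euclideanreal f" if "f \<in> ?T" for f
    using that continuous_map_product_projection[of _ V "\<lambda>_. euclideanreal"] by auto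
  then have "closedin (powertop_real V) {v \<in> topspace (powertop_real V). f v \<in> {0..}}" if "f \<in> ?T" for f
    using that by (intro closedin_continuous_map_preimage[of _ euclideanreal]) auto
  then have "closedin (powertop_real V) (\<Inter>f\<in>?T. {v \<in> topspace (powertop_real V). f v \<in> {0..}})"
    by (intro closedin_INT) auto
  moreover have "(\<Inter>f\<in>?T. {v \<in> topspace (powertop_real V). f v \<in> {0..}}) = psd_profile V I M"
    unfolding psd_profile_def psd_on_def nonneg_orthant_def by (auto simp: PiE_iff)
  ultimately show ?thesis by simp
qed

lemma minors22_eq:
  "minors22 V I M = {v \<in> nonneg_orthant V. \<forall>i\<in>I. \<forall>j\<in>I. i \<noteq> j \<longrightarrow> monomial_minor M i j v \<ge> 0}"
  by (simp add: minors22_def monomial_minor_def)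

lemma psd_profile_subset_minors22: "psd_profile V I M \<subseteq> minors22 V I M"
proof
  fix v assume profile: "v \<in> psd_profile V I M"
  have "monomial_minor M i j v \<ge> 0" if "i \<in> I" "j \<in> I" "i \<noteq> j" for i j
    using profile psd_on_minor[OF finite_index _ symmetric_eval that] symmetric_onD[OF symmetric that(1,2)]
    by (simp add: psd_profile_def monomial_minor_def power2_eq_square)
  then show "v \<in> minors22 V I M" using profile by (simp add: minors22_eq psd_profile_def)
qed

lemma monomial_minor_exp:
  assumes "\<And>C. C \<in> V \<Longrightarrow> v C = exp (y C)" "i \<in> I" "j \<in> I"
  shows "monomial_minor M i j v \<ge> 0 \<longleftrightarrow> log_minor M i j y \<ge> 0"
    and "monomial_minor M i j v > 0 \<longleftrightarrow> log_minor M i j y > 0"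
proof -
  have "eval_monomial (M a b + M a' b') v = exp (\<Sum>C\<in>#M a b + M a' b'. y C)"
    if "a \<in> I" "b \<in> I" "a' \<in> I" "b' \<in> I" for a b a' b'
    using entry_vars[OF that(1,2)] entry_vars[OF that(3,4)] assms(1) by (intro eval_monomial_exp) auto
  then have "monomial_minor M i j v = exp (\<Sum>C\<in>#M i i + M j j. y C) - exp (\<Sum>C\<in>#M i j + M j i. y C)"
    using assms(2,3) by (simp add: monomial_minor_def eval_monomial_union[symmetric] del: image_mset_union)
  then show "monomial_minor M i j v \<ge> 0 \<longleftrightarrow> log_minor M i j y \<ge> 0"
    and "monomial_minor M i j v > 0 \<longleftrightarrow> log_minor M i j y > 0"
    by (simp_all add: log_minor_def del: image_mset_union)
qed

lemma log_set_minors22_eq: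
  "log_set V (minors22 V I M) =
    {y \<in> V \<rightarrow>\<^sub>E UNIV. \<forall>i\<in>I. \<forall>j\<in>I. i \<noteq> j \<longrightarrow> log_minor M i j y \<ge> 0}"
proof -
  have "(\<lambda>C\<in>V. exp (y C)) \<in> nonneg_orthant V" for y :: "plgraph \<Rightarrow> real"
    by (auto simp: nonneg_orthant_def)
  then show ?thesis
    unfolding log_set_eq minors22_eq using monomial_minor_exp(1)[of "\<lambda>C\<in>V. exp (_ C)"] by simp
qed

lemma rational_polyhedral_cone_log_set_minors22:
  "rational_polyhedral_cone V (log_set V (minors22 V I M))"
proof -
  define coeffs :: "'i \<times> 'i \<Rightarrow> plgraph \<Rightarrow> rat" where
    "coeffs = (\<lambda>(i, j) C. of_nat (count (M i i + M j j) C) - of_nat (count (M i j + M j i) C))"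
  let ?pairs = "{(i, j). i \<in> I \<and> j \<in> I \<and> i \<noteq> j}"
  have "finite ?pairs" by (rule finite_subset[of _ "I \<times> I"]) (auto simp: finite_index)
  then have "finite (coeffs ` ?pairs)" by simp
  moreover have "(\<Sum>C\<in>V. of_rat (coeffs (i, j) C) * y C) = log_minor M i j y"
    if "i \<in> I" "j \<in> I" for i j and y :: "plgraph \<Rightarrow> real"
  proof -
    have vars: "set_mset (M i i + M j j) \<subseteq> V" "set_mset (M i j + M j i) \<subseteq> V"
      using entry_vars that by auto
    show ?thesis
      unfolding log_minor_def sum_mset_eq_sum_count[OF finite_vars vars(1)]
        sum_mset_eq_sum_count[OF finite_vars vars(2)]
      by (simp add: coeffs_def of_rat_diff of_rat_add sum_subtractf[symmetric] algebra_simps)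
  qed
  ultimately show ?thesis
    unfolding rational_polyhedral_cone_def log_set_minors22_eq
    by (intro exI[of _ "coeffs ` ?pairs"]) auto
qed

lemma eventually_exp_ray_in_psd_profile:
  assumes strict: "\<And>i j. i \<in> I \<Longrightarrow> j \<in> I \<Longrightarrow> i \<noteq> j \<Longrightarrow> log_minor M i j y > 0"
  shows "\<forall>\<^sub>F s in at_top. (\<lambda>C\<in>V. exp (s * y C)) \<in> psd_profile V I M"
proof -
  let ?v = "\<lambda>s. \<lambda>C\<in>V. exp (s * y C)" and ?n = "real (card I)"
  have entry: "eval_monomial (M i j) (?v s) = exp (s * (\<Sum>C\<in>#M i j. y C))" if "i \<in> I" "j \<in> I" for i j s
    using entry_vars[OF that]
    by (subst eval_monomial_exp[of _ _ "\<lambda>C. s * y C"]) (auto simp: sum_mset_distrib_left)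
  have "\<forall>\<^sub>F s in at_top. i \<noteq> j \<longrightarrow> ?n \<le> exp (s * log_minor M i j y / 2)" if "i \<in> I" "j \<in> I" for i j
    using eventually_ge_at_top[of "2 * ?n / log_minor M i j y"]
  proof eventually_elim
    case (elim s)
    have "?n \<le> s * log_minor M i j y / 2" if "i \<noteq> j"
      using elim strict[OF \<open>i \<in> I\<close> \<open>j \<in> I\<close> that] by (simp add: field_simps)
    moreover have "s * log_minor M i j y / 2 \<le> exp (s * log_minor M i j y / 2)"
      using exp_ge_add_one_self[of "s * log_minor M i j y / 2"] by linarith
    ultimately show ?case by linarith
  qed
  then have "\<forall>\<^sub>F s in at_top. \<forall>i\<in>I. \<forall>j\<in>I. i \<noteq> j \<longrightarrow> ?n \<le> exp (s * log_minor M i j y / 2)"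
    by (intro eventually_ball_finite[OF finite_index] ballI)
  then show ?thesis
  proof eventually_elim
    case (elim s)
    have "psd_on I (\<lambda>i j. eval_monomial (M i j) (?v s))"
    proof (rule psd_on_diagonally_dominant[where r = "\<lambda>i. exp (s * (\<Sum>C\<in>#M i i. y C) / 2)"])
      fix i j assume indices: "i \<in> I" "j \<in> I" "i \<noteq> j"
      have "exp (s * (\<Sum>C\<in>#M i j. y C)) * ?n \<le> exp (s * (\<Sum>C\<in>#M i j. y C)) * exp (s * log_minor M i j y / 2)"
        using elim indices by simp
      also have "\<dots> = exp (s * (\<Sum>C\<in>#M i i. y C) / 2) * exp (s * (\<Sum>C\<in>#M j j. y C) / 2)"
        by (simp add: exp_add[symmetric] log_minor_def symmetric_onD[OF symmetric indices(2,1)] field_simps)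
      finally show "\<bar>eval_monomial (M i j) (?v s)\<bar> * card I \<le>
          exp (s * (\<Sum>C\<in>#M i i. y C) / 2) * exp (s * (\<Sum>C\<in>#M j j. y C) / 2)"
        using indices by (simp add: entry)
    qed (simp_all add: finite_index entry exp_double[symmetric])
    then show ?case by (auto simp: psd_profile_def nonneg_orthant_def)
  qed
qed

lemma strictly_feasible_exponents:
  assumes separated: "\<And>i j. i \<in> I \<Longrightarrow> j \<in> I \<Longrightarrow> i \<noteq> j \<Longrightarrow>
    \<exists>v \<in> psd_profile V I M \<inter> pos_orthant V. monomial_minor M i j v > 0"
  obtains y where "\<And>i j. i \<in> I \<Longrightarrow> j \<in> I \<Longrightarrow> i \<noteq> j \<Longrightarrow> log_minor M i j y > 0"
proof -
  let ?pairs = "{(i, j). i \<in> I \<and> j \<in> I \<and> i \<noteq> j}"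
  have finite_pairs: "finite ?pairs" by (rule finite_subset[of _ "I \<times> I"]) (auto simp: finite_index)
  obtain v where profile: "\<And>i j. i \<in> I \<Longrightarrow> j \<in> I \<Longrightarrow> i \<noteq> j \<Longrightarrow> v i j \<in> psd_profile V I M \<inter> pos_orthant V"
    and strict: "\<And>i j. i \<in> I \<Longrightarrow> j \<in> I \<Longrightarrow> i \<noteq> j \<Longrightarrow> monomial_minor M i j (v i j) > 0"
    using separated by metis
  define y where "y C = (\<Sum>p\<in>?pairs. ln (v (fst p) (snd p) C))" for C
  have exp_ln: "v i j C = exp (ln (v i j C))" if "i \<in> I" "j \<in> I" "i \<noteq> j" "C \<in> V" for i j C
    using profile[OF that(1-3)] that(4) by (auto simp: pos_orthant_def PiE_iff)
  have "log_minor M i j y > 0" if indices: "i \<in> I" "j \<in> I" "i \<noteq> j" for i j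
    unfolding y_def[abs_def] log_minor_sum[OF finite_pairs]
  proof (rule sum_pos2[OF finite_pairs])
    show "(i, j) \<in> ?pairs" using indices by simp
    show "log_minor M i j (\<lambda>C. ln (v (fst (i, j)) (snd (i, j)) C)) > 0"
      using monomial_minor_exp(2)[of "v i j" "\<lambda>C. ln (v i j C)" i j] exp_ln[OF indices] strict[OF indices]
        indices by simp
    show "log_minor M i j (\<lambda>C. ln (v (fst p) (snd p) C)) \<ge> 0" if pair: "p \<in> ?pairs" for p
    proof -
      have pair_indices: "fst p \<in> I" "snd p \<in> I" "fst p \<noteq> snd p" using pair by auto
      have "v (fst p) (snd p) \<in> minors22 V I M"
        using profile[OF pair_indices] psd_profile_subset_minors22 by blast
      then have "monomial_minor M i j (v (fst p) (snd p)) \<ge> 0"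
        using indices by (simp add: minors22_eq)
      then show ?thesis
        using monomial_minor_exp(1)[of "v (fst p) (snd p)" "\<lambda>C. ln (v (fst p) (snd p) C)" i j]
          exp_ln[OF pair_indices] indices by simp
    qed
  qed
  then show thesis by (rule that)
qed

theorem trop_psd_profile:
  assumes separated: "\<And>i j. i \<in> I \<Longrightarrow> j \<in> I \<Longrightarrow> i \<noteq> j \<Longrightarrow>
    \<exists>v \<in> psd_profile V I M \<inter> pos_orthant V. monomial_minor M i j v > 0"
  shows "trop V (psd_profile V I M) = log_set V (minors22 V I M)"
proof
  show "trop V (psd_profile V I M) \<subseteq> log_set V (minors22 V I M)"
    by (intro trop_subset_cone rational_polyhedral_cone_log_set_minors22 log_set_mono
        psd_profile_subset_minors22)
  show "log_set V (minors22 V I M) \<subseteq> trop V (psd_profile V I M)"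
  proof
    fix y assume "y \<in> log_set V (minors22 V I M)"
    then have cone_point: "y \<in> V \<rightarrow>\<^sub>E UNIV" "\<And>i j. i \<in> I \<Longrightarrow> j \<in> I \<Longrightarrow> i \<noteq> j \<Longrightarrow> log_minor M i j y \<ge> 0"
      unfolding log_set_minors22_eq by blast+
    obtain y0 where strict_point: "\<And>i j. i \<in> I \<Longrightarrow> j \<in> I \<Longrightarrow> i \<noteq> j \<Longrightarrow> log_minor M i j y0 > 0"
      using strictly_feasible_exponents[OF separated] by blast
    define z where "z k C = y C + 1 / real (Suc k) * y0 C" for k C
    have "log_minor M i j (z k) > 0" if "i \<in> I" "j \<in> I" "i \<noteq> j" for i j k
      unfolding z_def[abs_def] log_minor_add log_minor_cmult
      using cone_point(2)[OF that] strict_point[OF that] by (intro add_nonneg_pos mult_pos_pos) auto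
    then have "\<forall>\<^sub>F s in at_top. (\<lambda>C\<in>V. exp (s * z k C)) \<in> psd_profile V I M" for k
      by (rule eventually_exp_ray_in_psd_profile)
    moreover have "(\<lambda>k. z k C) \<longlonglongrightarrow> y C" for C
    proof -
      have "(\<lambda>k. y C + 1 / real (Suc k) * y0 C) \<longlonglongrightarrow> y C + 0 * y0 C"
        by (intro tendsto_intros LIMSEQ_Suc[OF lim_1_over_n])
      then show ?thesis by (simp add: z_def)
    qed
    ultimately show "y \<in> trop V (psd_profile V I M)" using trop_limit_of_rays[OF cone_point(1)] by blast
  qed
qed

end


section \<open>The sums-of-squares profile\<close>

lemma eval_comb_eq_linear_extension:
  "eval_comb a v = linear_extension (\<lambda>H. eval_monomial (graph_components H) v) a"
  by (simp add: eval_comb_def linear_extension_def)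

lemma linear_extension_comb_unlabel:
  "linear_extension f (comb_unlabel a) = linear_extension (\<lambda>H. f (unlabel H)) a"
  unfolding comb_unlabel_def linear_extension_sum linear_extension_single
  by (simp add: linear_extension_def)

lemma eval_comb_sos:
  "eval_comb (sos_comb bs) v = (\<Sum>b\<leftarrow>bs. quadratic_form (Poly_Mapping.keys b)
     (\<lambda>A B. eval_monomial (moment_matrix A B) v) (Poly_Mapping.lookup b))"
proof -
  have "eval_comb (comb_unlabel (comb_mult b b)) v = quadratic_form (Poly_Mapping.keys b)
     (\<lambda>A B. eval_monomial (moment_matrix A B) v) (Poly_Mapping.lookup b)" for b
    unfolding eval_comb_eq_linear_extension linear_extension_comb_unlabel comb_mult_def linear_extension_sum
      linear_extension_single quadratic_form_def moment_matrix_def ..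
  then show ?thesis
    unfolding sos_comb_def
    by (induction bs)
      (simp_all add: eval_comb_eq_linear_extension linear_extension_add linear_extension_zero)
qed

lemma sos_nonneg_iff_psd_on_basis:
  assumes "label_bound d l"
  shows "(\<forall>a. is_sos d a \<longrightarrow> eval_comb a v \<ge> 0) \<longleftrightarrow>
    psd_on (basis d l) (\<lambda>A B. eval_monomial (moment_matrix A B) v)"
    (is "_ \<longleftrightarrow> psd_on ?B ?M")
proof
  assume sos: "\<forall>a. is_sos d a \<longrightarrow> eval_comb a v \<ge> 0"
  show "psd_on ?B ?M"
  proof (rule psd_onI)
    fix x :: "plgraph \<Rightarrow> real"
    define b where "b = (\<Sum>A\<in>?B. Poly_Mapping.single A (x A))"
    have lookup_b: "Poly_Mapping.lookup b A = (if A \<in> ?B then x A else 0)" for A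
      using finite_basis by (simp add: b_def lookup_sum lookup_single when_def)
    then have keys_b: "Poly_Mapping.keys b \<subseteq> ?B" by (auto simp: in_keys_iff split: if_splits)
    then have "is_sos d (sos_comb [b])"
      unfolding is_sos_def by (intro exI[of _ "[b]"]) (auto simp: basis_iff)
    then have "0 \<le> eval_comb (sos_comb [b]) v" using sos by blast
    also have "\<dots> = quadratic_form (Poly_Mapping.keys b) ?M (Poly_Mapping.lookup b)"
      by (simp add: eval_comb_sos)
    also have "\<dots> = quadratic_form ?B ?M (Poly_Mapping.lookup b)"
      by (rule quadratic_form_superset[OF finite_basis keys_b, symmetric]) (simp add: in_keys_iff)
    also have "\<dots> = quadratic_form ?B ?M x" by (rule quadratic_form_cong) (simp_all add: lookup_b)
    finally show "quadratic_form ?B ?M x \<ge> 0" .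
  qed
next
  assume psd: "psd_on ?B ?M"
  show "\<forall>a. is_sos d a \<longrightarrow> eval_comb a v \<ge> 0"
  proof (intro allI impI)
    fix a assume "is_sos d a"
    then obtain bs where squares: "\<And>b. b \<in> set bs \<Longrightarrow> Poly_Mapping.keys b \<subseteq> ?B" "a = sos_comb bs"
      using assms unfolding label_bound_def by (metis basis_iff subsetI)
    have "quadratic_form (Poly_Mapping.keys b) ?M (Poly_Mapping.lookup b) \<ge> 0" if "b \<in> set bs" for b
      using psd_onD[OF psd_on_subset[OF finite_basis psd squares(1)[OF that]]] .
    then show "eval_comb a v \<ge> 0"
      unfolding squares(2) eval_comb_sos by (intro sum_list_nonneg) auto
  qed
qed

lemma psd_on_basis_iff_reduced:
  "psd_on (basis d l) (\<lambda>A B. eval_monomial (moment_matrix A B) v) \<longleftrightarrow>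
    psd_on (reduced_basis d l) (\<lambda>A B. eval_monomial (moment_matrix A B) v)"
    (is "_ \<longleftrightarrow> psd_on ?R ?M")
proof
  assume psd: "psd_on ?R ?M"
  have "\<forall>A\<in>basis d l. \<exists>r m. r \<in> ?R \<and> (\<forall>B. moment_matrix A B = moment_matrix r B + m)"
    using moment_matrix_reduce by metis
  then obtain r m where into_reduced: "r ` basis d l \<subseteq> ?R"
    and reduce: "\<And>A B. A \<in> basis d l \<Longrightarrow> moment_matrix A B = moment_matrix (r A) B + m A"
    by (metis image_subsetI)
  have "?M A B = eval_monomial (m A) v * eval_monomial (m B) v * ?M (r A) (r B)"
    if "A \<in> basis d l" "B \<in> basis d l" for A B
    using reduce[OF that(1), of B] reduce[OF that(2), of "r A"]
    by (simp add: moment_matrix_commute[of _ B] moment_matrix_commute[of "r B"] eval_monomial_union)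
  then show "psd_on (basis d l) ?M"
    by (rule psd_on_cong[THEN iffD2, OF _
          psd_on_congruence[OF psd finite_basis finite_reduced_basis into_reduced]])
qed (rule psd_on_subset[OF finite_basis _ reduced_basis_subset])

abbreviation moment_profile :: "nat \<Rightarrow> nat \<Rightarrow> (plgraph \<Rightarrow> real) set" where
  "moment_profile d l \<equiv> psd_profile (variables d l) (reduced_basis d l) moment_matrix"

lemma sos_profile_eq_moment_profile: "label_bound d l \<Longrightarrow> sos_profile d l = moment_profile d l"
  by (simp add: sos_profile_def psd_profile_def sos_nonneg_iff_psd_on_basis psd_on_basis_iff_reduced)

interpretation moments: monomial_matrix "variables d l" "reduced_basis d l" moment_matrix for d l
proof
  show "set_mset (moment_matrix A B) \<subseteq> variables d l"
    if "A \<in> reduced_basis d l" "B \<in> reduced_basis d l" for A B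
    using moment_matrix_variables that reduced_basis_subset by blast
  show "symmetric_on (reduced_basis d l) moment_matrix"
    using moment_matrix_commute by (simp add: symmetric_on_def)
qed (rule finite_variables finite_reduced_basis)+

lemma eval_moment_matrix_restrict:
  assumes "A \<in> reduced_basis d l" "B \<in> reduced_basis d l"
  shows "eval_monomial (moment_matrix A B) (restrict v (variables d l)) =
    eval_monomial (moment_matrix A B) v"
  using moments.entry_vars[OF assms] by (intro eval_monomial_cong) auto

lemma densities_in_moment_profile:
  assumes "finite W" "W \<noteq> {}"
  shows "(\<lambda>C\<in>variables d l. hom_density C W D) \<in> moment_profile d l"
proof -
  have "psd_on (reduced_basis d l)
      (\<lambda>A B. eval_monomial (moment_matrix A B) (\<lambda>C\<in>variables d l. hom_density C W D))"
    by (rule psd_on_cong[THEN iffD2, OF eval_moment_matrix_restrict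
          psd_on_density_matrix[OF reduced_basis_subset assms]])
  then show ?thesis using hom_density_nonneg[OF assms(1)] by (simp add: psd_profile_def nonneg_orthant_def)
qed

lemma graph_profile_subset_moment_profile:
  "graph_profile (variables d l) \<subseteq> moment_profile d l"
  unfolding graph_profile_def
  by (rule closure_of_minimal[OF _ moments.closedin_psd_profile])
    (auto simp: simple_graph_def intro: densities_in_moment_profile)

lemma moment_matrix_separated:
  assumes "A \<in> reduced_basis d l" "B \<in> reduced_basis d l" "A \<noteq> B"
  shows "\<exists>v \<in> moment_profile d l \<inter> pos_orthant (variables d l). monomial_minor moment_matrix A B v > 0"
proof -
  obtain F where "pl_edges F" "card (label_homs (rep_plgraph A) F) \<noteq> card (label_homs (rep_plgraph B) F)"
    using label_hom_counts_separate[OF assms(3)] by blast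
  then obtain W D where target: "finite W" "0 \<in> W" "{0} \<in> D"
    and strict: "(density_matrix W D A B)\<^sup>2 < density_matrix W D A A * density_matrix W D B B"
    using strict_density_minor_of_counts[OF assms(1,2)] by blast
  let ?v = "\<lambda>C\<in>variables d l. hom_density C W D"
  have "?v \<in> moment_profile d l"
    using target by (intro densities_in_moment_profile) auto
  moreover have "?v \<in> pos_orthant (variables d l)"
    using hom_density_pos[OF target] by (simp add: pos_orthant_def)
  moreover have "monomial_minor moment_matrix A B ?v > 0"
    using strict assms
    by (simp add: monomial_minor_def eval_moment_matrix_restrict moment_matrix_commute[of B A]
        power2_eq_square)
  ultimately show ?thesis by blast
qed

theorem theorem4p12:
  fixes d l :: nat
  assumes "d > 0" and "label_bound d l"
  shows "finite (variables d l)
    \<and> basic_semialgebraic (variables d l) (sos_profile d l)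
    \<and> graph_profile (variables d l) \<subseteq> sos_profile d l
    \<and> trop (variables d l) (sos_profile d l)
        = log_set (variables d l) (minors22 (variables d l) (reduced_basis d l) moment_matrix)
    \<and> rational_polyhedral_cone (variables d l)
        (log_set (variables d l) (minors22 (variables d l) (reduced_basis d l) moment_matrix))"
  unfolding sos_profile_eq_moment_profile[OF assms(2)]
  by (intro conjI finite_variables moments.basic_semialgebraic_psd_profile
      graph_profile_subset_moment_profile moments.trop_psd_profile moment_matrix_separated
      moments.rational_polyhedral_cone_log_set_minors22)

end
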